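(* The group of isometries of $T\mathcal{N}$ (not necessarily holomorphic) is the semi-direct product $\mathrm{SL}^{\pm}(2,\mathbb{R})\ltimes\mathbb{R}^2$. That is, under the identification $T\mathcal{N}\cong\mathbb{H}\times\mathbb{C}$ and viewing $\mathrm{SL}^{\pm}(2,\mathbb{R})\ltimes\mathbb{R}^2$ as a subgroup of $\mathrm{Diff}(\mathbb{H}\times\mathbb{C})\cong\mathrm{Diff}(T\mathcal{N})$ through its effective action, the set of diffeomorphisms $\varphi$ of $T\mathcal{N}$ with $\varphi^*g=g$ is exactly $\mathrm{SL}^{\pm}(2,\mathbb{R})\ltimes\mathbb{R}^2$.
   Context: $\mathcal{N}$ is the manifold of Gaussian densities $p(x;\mu,\sigma)=\frac{1}{\sqrt{2\pi}\sigma}e^{-(x-\mu)^2/(2\sigma^2)}$ on $\mathbb{R}$, with global natural coordinates $\theta_1=\mu/\sigma^2\in\mathbb{R}$, $\theta_2=-1/(2\sigma^2)<0$. $T\mathcal{N}$ carries the Kähler structure $(g,J,\omega)$ obtained by Dombrowski's construction from the Fisher metric $h_F$ and the exponential connection. Explicitly, with $\dot\theta_i=d\theta_i$ viewed as functions on $T\mathcal{N}$, $(\theta_1,\theta_2,\dot\theta_1,\dot\theta_2)$ are global coordinates on $T\mathcal{N}$ in which (with $I$ the $2\times 2$ identity matrix) $$g=\begin{bmatrix} h_F(\theta) & 0 \\ 0 & h_F(\theta) \end{bmatrix},\quad J=\begin{bmatrix} 0 & -I \\ I & 0 \end{bmatrix},\quad h_F(\theta)=\frac{1}{2\theta_2^2}\begin{bmatrix}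 -\theta_2 & \theta_1 \\ \theta_1 & \frac{\theta_2-\theta_1^2}{\theta_2} \end{bmatrix}.$$ With $z_k=\theta_k+i\dot\theta_k$ and $\mathbb{H}=\{\tau\in\mathbb{C}\mid\mathrm{Im}(\tau)>0\}$, $T\mathcal{N}$ is identified with $\mathbb{H}\times\mathbb{C}$ via $(z_1,z_2)\mapsto(\tau,z)=(-iz_2,iz_1)$. $\mathrm{SL}^{\pm}(2,\mathbb{R})$ is the group of real $2\times2$ matrices of determinant $\pm1$; $\mathrm{SL}^{\pm}(2,\mathbb{R})\ltimes\mathbb{R}^2$ has multiplication $(M_1,X_1)\cdot(M_2,X_2)=(M_1M_2,X_1M_2+X_2)$ (row vectors $X_i$). It acts effectively on $\mathbb{H}\times\mathbb{C}$ by $$\Big(\begin{bmatrix} a & b \\ c & d \end{bmatrix},(\lambda,\mu)\Big)\cdot(\tau,z)=\begin{cases} \Big(\frac{a\tau+b}{c\tau+d},\frac{z+\lambda\tau+\mu}{c\tau+d}\Big) & \text{if } ad-bc=1, \\[1ex] \Big(\frac{a\bar\tau+b}{c\bar\tau+d},\frac{\bar z+\lambda\bar\tau+\mu}{c\bar\tau+d}\Big) & \text{if } ad-bc=-1. \end{cases}$$ *)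

theory Defs
  imports "HOL-Analysis.Analysis" "HOL-Algebra.Bij"
begin

section \<open>Smooth maps and diffeomorphisms of open subsets of Euclidean space\<close>

text \<open>
  The notions below are meant for open \<open>S\<close>, where \<^term>\<open>frechet_derivative f (at x)\<close> only
  depends on the restriction of \<open>f\<close> to \<open>S\<close>.
\<close>

fun Ck_on :: "nat \<Rightarrow> 'a::euclidean_space set \<Rightarrow> ('a \<Rightarrow> 'b::euclidean_space) \<Rightarrow> bool" where
  "Ck_on 0 S f \<longleftrightarrow> continuous_on S f"
| "Ck_on (Suc k) S f \<longleftrightarrow>
     (\<forall>x\<in>S. f differentiable (at x)) \<and> (\<forall>v. Ck_on k S (\<lambda>x. frechet_derivative f (at x) v))"

definition smooth_on :: "'a::euclidean_space set \<Rightarrow> ('a \<Rightarrow> 'b::euclidean_space) \<Rightarrow> bool" where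
  "smooth_on S f \<longleftrightarrow> (\<forall>k. Ck_on k S f)"

text \<open>
  As in \<^const>\<open>Bij\<close>, a self-map of \<open>S\<close> is represented by its extensional representative, so
  that equality of functions is equality on \<open>S\<close>.
\<close>

definition Diff :: "'a::euclidean_space set \<Rightarrow> ('a \<Rightarrow> 'a) set" where
  "Diff S = {\<phi> \<in> Bij S. smooth_on S \<phi> \<and> smooth_on S (inv_into S \<phi>)}"

section \<open>The tangent bundle of the manifold of Gaussian densities\<close>

text \<open>
  A point of the tangent bundle is the pair \<open>(\<theta>, \<theta>')\<close>, where \<open>\<theta>\<close> are the natural coordinates
  of the base point and \<open>\<theta>'\<close> the components of the tangent vector.
\<close>

type_synonym point = "(real^2) \<times> (real^2)"

definition TN :: "point set" where
  "TN = {(\<theta>, \<theta>'). \<theta>$2 < 0}"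

definition fisher :: "real^2 \<Rightarrow> real^2^2" where
  "fisher \<theta> = (1 / (2 * (\<theta>$2)\<^sup>2)) *\<^sub>R
     vector [vector [- \<theta>$2, \<theta>$1],
             vector [\<theta>$1, (\<theta>$2 - (\<theta>$1)\<^sup>2) / \<theta>$2]]"

definition gTN :: "point \<Rightarrow> point \<Rightarrow> point \<Rightarrow> real" where
  "gTN = (\<lambda>(\<theta>, \<theta>') (u, u') (v, v'). u \<bullet> (fisher \<theta> *v v) + u' \<bullet> (fisher \<theta> *v v'))"

definition pullback :: "(point \<Rightarrow> point) \<Rightarrow> (point \<Rightarrow> point \<Rightarrow> point \<Rightarrow> real)
    \<Rightarrow> (point \<Rightarrow> point \<Rightarrow> point \<Rightarrow> real)" where
  "pullback \<phi> g = (\<lambda>p u v. g (\<phi> p) (frechet_derivative \<phi> (at p) u) (frechet_derivative \<phi> (at p) v))"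

definition Isom_TN :: "(point \<Rightarrow> point) set" where
  "Isom_TN = {\<phi> \<in> Diff TN. \<forall>p\<in>TN. pullback \<phi> gTN p = gTN p}"

abbreviation Isom_group :: "(point \<Rightarrow> point) monoid" where
  "Isom_group \<equiv> (BijGroup TN) \<lparr>carrier := Isom_TN\<rparr>"

section \<open>The group \<open>SL\<^sup>\<plusminus>(2,\<real>) \<ltimes> \<real>\<^sup>2\<close> and its action\<close>

definition SLpm :: "(real^2^2) set" where
  "SLpm = {M. det M = 1 \<or> det M = -1}"

definition SLpm_R2 :: "((real^2^2) \<times> (real^2)) monoid" where
  "SLpm_R2 = \<lparr>carrier = SLpm \<times> UNIV,
     mult = (\<lambda>(M1, X1) (M2, X2). (M1 ** M2, X1 v* M2 + X2)),
     one = (mat 1, 0)\<rparr>"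

definition HC :: "(complex \<times> complex) set" where
  "HC = {\<tau>. Im \<tau> > 0} \<times> UNIV"

text \<open>The \<open>else\<close> branch is meant for determinant \<open>-1\<close>; other matrices are not in \<^const>\<open>SLpm\<close>.\<close>

definition act :: "(real^2^2) \<times> (real^2) \<Rightarrow> complex \<times> complex \<Rightarrow> complex \<times> complex" where
  "act = (\<lambda>(M, X) (\<tau>, z).
     let a = complex_of_real (M$1$1); b = complex_of_real (M$1$2);
         c = complex_of_real (M$2$1); d = complex_of_real (M$2$2);
         l = complex_of_real (X$1); m = complex_of_real (X$2)
     in if det M = 1
        then ((a * \<tau> + b) / (c * \<tau> + d), (z + l * \<tau> + m) / (c * \<tau> + d))
        else ((a * cnj \<tau> + b) / (c * cnj \<tau> + d), (cnj z + l * cnj \<tau> + m) / (c * cnj \<tau> + d)))"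

definition ident :: "point \<Rightarrow> complex \<times> complex" where
  "ident = (\<lambda>(\<theta>, \<theta>').
     let z1 = Complex (\<theta>$1) (\<theta>'$1); z2 = Complex (\<theta>$2) (\<theta>'$2) in (- \<i> * z2, \<i> * z1))"

lemma bij_betw_ident: "bij_betw ident TN HC"
proof (rule bij_betwI[where g = "\<lambda>(\<tau>, z).
    (vector [Im z, - Im \<tau>] :: real^2, vector [- Re z, Re \<tau>] :: real^2)"])
qed (auto simp: ident_def TN_def HC_def vec_eq_iff forall_2 complex_eq_iff)

definition act_TN :: "(real^2^2) \<times> (real^2) \<Rightarrow> point \<Rightarrow> point" where
  "act_TN A = (\<lambda>p\<in>TN. inv_into TN ident (act A (ident p)))"

end

theory Submission
  imports Defs "HOL-Algebra.Coset"
begin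

text \<open>
  In the coordinates \<open>\<tau> = x + iy\<close>, \<open>z = u + iv\<close> on \<open>\<H> \<times> \<complex>\<close> the metric is
  \<open>|d\<tau>|\<^sup>2 / (2 y\<^sup>2) + |dz - (v/y) d\<tau>|\<^sup>2 / (2 y)\<close>, and its Ricci tensor is \<open>-(3/2) |d\<tau>|\<^sup>2 / y\<^sup>2\<close>.
  An isometry \<open>\<psi> = (f, S)\<close> preserves the Ricci tensor, hence each of the two summands of the metric;
  in particular \<open>f\<close> depends on \<open>\<tau>\<close> only. The transformation law of the Christoffel symbols in the
  vertical directions reads \<open>Df(i b\<^sup>2) = i (DS(0, b))\<^sup>2\<close>, which forces \<open>b \<mapsto> DS(0, b)\<close> to be complex
  linear or antilinear; up to the reflection \<open>(\<tau>, z) \<mapsto> (-cnj \<tau>, cnj z)\<close> it is multiplication by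
  a function \<open>\<alpha>\<close>. Then \<open>1/\<alpha>\<close>, \<open>f/\<alpha>\<close> and \<open>S/\<alpha> - z\<close> all satisfy \<open>dF = (Im F / y) d\<tau>\<close>, whose
  solutions are \<open>r\<tau> + s\<close> with real \<open>r\<close>, \<open>s\<close>, and this is the asserted form of \<open>\<psi>\<close>.
\<close>

section \<open>Transformation of Christoffel symbols and curvature under isometries\<close>

text \<open>The mean value theorem for s -> f (p + s u + t v) - f (p + s u) turns the second
  difference into t times a difference of first derivatives; differentiability of q ->
  \<open>D q u\<close> at p evaluates that difference up to o(t).\<close>

lemma second_difference_quotient:
  fixes f :: "'a::real_normed_vector \<Rightarrow> real"
  assumes S: "open S" "p \<in> S"
    and D: "\<And>q. q \<in> S \<Longrightarrow> (f has_derivative D q) (at q)"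
    and A: "((\<lambda>q. D q u) has_derivative A) (at p)"
  shows "((\<lambda>t. (f (p + t *\<^sub>R u + t *\<^sub>R v) - f (p + t *\<^sub>R u) - f (p + t *\<^sub>R v) + f p) / t\<^sup>2)
    \<longlongrightarrow> A v) (at_right 0)"
proof (rule tendstoI)
  fix e :: real assume e: "e > 0"
  \<comment> \<open>The two first-order errors below add up to at most
    \<open>e / (2 * K) * t * (2 * norm u + norm v)\<close>, hence to at most
    \<open>t * e / 2\<close>; the summand 1 keeps \<open>K\<close> positive when u and v
    vanish.\<close>
  define K where "K = 2 * norm u + norm v + 1"
  have K: "K > 0" by (simp add: K_def add_nonneg_pos)
  interpret A: bounded_linear A using A by (rule has_derivative_bounded_linear)
  obtain d1 where d1: "d1 > 0" "ball p d1 \<subseteq> S" using S open_contains_ball by blast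
  have "e / (2 * K) > 0" using e K by simp
  then obtain d2 where d2: "d2 > 0"
    "\<And>q. norm (q - p) < d2 \<Longrightarrow> norm (D q u - D p u - A (q - p)) \<le> e / (2 * K) * norm (q - p)"
    using A unfolding has_derivative_at_alt by blast
  define d where "d = min d1 d2 / K"
  have d: "d > 0" using d1 d2 K by (simp add: d_def)
  have "dist ((f (p + t *\<^sub>R u + t *\<^sub>R v) - f (p + t *\<^sub>R u) - f (p + t *\<^sub>R v) + f p) / t\<^sup>2) (A v) < e"
    if t: "0 < t" "t < d" for t
  proof -
    have tK: "t * K < min d1 d2" using t K by (simp add: d_def pos_less_divide_eq)
    have small: "norm (s *\<^sub>R u + r *\<^sub>R v) \<le> t * (norm u + norm v)" if "0 \<le> s" "s \<le> t" "0 \<le> r" "r \<le> t" for s r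
    proof -
      have "norm (s *\<^sub>R u + r *\<^sub>R v) \<le> s * norm u + r * norm v"
        using norm_triangle_ineq[of "s *\<^sub>R u" "r *\<^sub>R v"] that by simp
      also have "\<dots> \<le> t * norm u + t * norm v"
        using that by (intro add_mono mult_right_mono) auto
      finally show ?thesis by (simp add: algebra_simps)
    qed
    have lt: "t * (norm u + norm v) < min d1 d2"
      using tK t by (intro le_less_trans[OF _ tK] mult_left_mono) (auto simp: K_def)
    have near: "p + s *\<^sub>R u + r *\<^sub>R v \<in> S" if "0 \<le> s" "s \<le> t" "0 \<le> r" "r \<le> t" for s r
    proof -
      have "norm (s *\<^sub>R u + r *\<^sub>R v) < d1" using small[OF that] lt by simp
      moreover have "dist p (p + s *\<^sub>R u + r *\<^sub>R v) = norm (s *\<^sub>R u + r *\<^sub>R v)"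
        by (metis add.assoc add_diff_cancel_left' dist_norm norm_minus_commute)
      ultimately show ?thesis using d1 by auto
    qed
    define h where "h s = f (p + s *\<^sub>R u + t *\<^sub>R v) - f (p + s *\<^sub>R u)" for s
    have "(h has_derivative (\<lambda>r. D (p + s *\<^sub>R u + t *\<^sub>R v) (r *\<^sub>R u) - D (p + s *\<^sub>R u) (r *\<^sub>R u))) (at s within {0..t})"
      if "0 \<le> s" "s \<le> t" for s
    proof -
      have 1: "((\<lambda>s. p + s *\<^sub>R u + t *\<^sub>R v) has_derivative (\<lambda>r. r *\<^sub>R u)) (at s within {0..t})"
        by (auto intro!: derivative_eq_intros)
      have 2: "((\<lambda>s. p + s *\<^sub>R u) has_derivative (\<lambda>r. r *\<^sub>R u)) (at s within {0..t})"
        by (auto intro!: derivative_eq_intros)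
      have q: "p + s *\<^sub>R u + t *\<^sub>R v \<in> S" "p + s *\<^sub>R u \<in> S"
        using near[of s t] near[of s 0] that t by auto
      show ?thesis unfolding h_def
        by (rule has_derivative_diff[OF has_derivative_compose[OF 1 D[OF q(1)]] has_derivative_compose[OF 2 D[OF q(2)]]])
    qed
    then obtain s where s: "0 < s" "s < t"
      and hs: "h t - h 0 = D (p + s *\<^sub>R u + t *\<^sub>R v) ((t - 0) *\<^sub>R u) - D (p + s *\<^sub>R u) ((t - 0) *\<^sub>R u)"
      using mvt_simple[OF t(1), of h "\<lambda>s r. D (p + s *\<^sub>R u + t *\<^sub>R v) (r *\<^sub>R u) - D (p + s *\<^sub>R u) (r *\<^sub>R u)"]
      by auto
    let ?q1 = "p + s *\<^sub>R u + t *\<^sub>R v" and ?q2 = "p + s *\<^sub>R u"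
    have q: "?q1 \<in> S" "?q2 \<in> S" using near[of s t] near[of s 0] s t by auto
    have lin: "D q (t *\<^sub>R u) = t * D q u" if "q \<in> S" for q
      using linear_scale[OF has_derivative_linear[OF D[OF that]], of t u] by simp
    have e1: "h t - h 0 = t * (D ?q1 u - D ?q2 u)" using hs q by (simp add: lin algebra_simps)
    have b1: "norm (D ?q1 u - D p u - A (?q1 - p)) \<le> e / (2 * K) * (t * (norm u + norm v))"
    proof -
      have n: "norm (?q1 - p) \<le> t * (norm u + norm v)"
        using small[of s t] s t by (simp add: algebra_simps)
      then have "norm (D ?q1 u - D p u - A (?q1 - p)) \<le> e / (2 * K) * norm (?q1 - p)"
        using lt by (intro d2) simp
      also have "\<dots> \<le> e / (2 * K) * (t * (norm u + norm v))"
        using n e K by (intro mult_left_mono) auto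
      finally show ?thesis .
    qed
    have b2: "norm (D ?q2 u - D p u - A (?q2 - p)) \<le> e / (2 * K) * (t * norm u)"
    proof -
      have n: "norm (?q2 - p) \<le> t * norm u" using s by (auto intro: mult_right_mono)
      moreover have "t * norm u \<le> t * (norm u + norm v)" using t by simp
      ultimately have "norm (D ?q2 u - D p u - A (?q2 - p)) \<le> e / (2 * K) * norm (?q2 - p)"
        using lt by (intro d2) simp
      also have "\<dots> \<le> e / (2 * K) * (t * norm u)"
        using n e K by (intro mult_left_mono) auto
      finally show ?thesis .
    qed
    have "A (?q1 - p) - A (?q2 - p) = t * A v"
      by (simp add: A.diff[symmetric]) (simp add: A.scaleR)
    then have "norm (D ?q1 u - D ?q2 u - t * A v) \<le> e / (2 * K) * (t * (norm u + norm v)) + e / (2 * K) * (t * norm u)"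
      using b1 b2 by (simp add: abs_le_iff)
    also have "\<dots> = t * (e / (2 * K) * (2 * norm u + norm v))" by (simp add: algebra_simps)
    also have "\<dots> < t * e"
    proof -
      have "e / (2 * K) * (2 * norm u + norm v) \<le> e / (2 * K) * K"
        using e K by (intro mult_left_mono) (auto simp: K_def)
      also have "\<dots> < e" using e K by simp
      finally show ?thesis using t by (intro mult_strict_left_mono)
    qed
    finally have b3: "\<bar>D ?q1 u - D ?q2 u - t * A v\<bar> < t * e" by simp
    have "(f (p + t *\<^sub>R u + t *\<^sub>R v) - f (p + t *\<^sub>R u) - f (p + t *\<^sub>R v) + f p) = t * (D ?q1 u - D ?q2 u)"
      using e1 by (simp add: h_def)
    then have "(f (p + t *\<^sub>R u + t *\<^sub>R v) - f (p + t *\<^sub>R u) - f (p + t *\<^sub>R v) + f p) / t\<^sup>2 - A v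
       = (D ?q1 u - D ?q2 u - t * A v) / t"
      using t by (simp add: diff_divide_distrib power2_eq_square)
    then have "dist ((f (p + t *\<^sub>R u + t *\<^sub>R v) - f (p + t *\<^sub>R u) - f (p + t *\<^sub>R v) + f p) / t\<^sup>2) (A v)
       = \<bar>D ?q1 u - D ?q2 u - t * A v\<bar> / t" using t by (simp add: dist_real_def)
    also have "\<dots> < e" using b3 t by (simp add: divide_simps mult.commute)
    finally show ?thesis .
  qed
  then show "\<forall>\<^sub>F t in at_right 0. dist ((f (p + t *\<^sub>R u + t *\<^sub>R v) - f (p + t *\<^sub>R u) - f (p + t *\<^sub>R v) + f p) / t\<^sup>2) (A v) < e"
    using d unfolding eventually_at_right_field by auto
qed

text \<open>The second difference is symmetric in u and v, so the two limits agree; components along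
  \<open>Basis\<close> reduce to real values.\<close>

lemma symmetric_second_derivative:
  fixes f :: "'a::real_normed_vector \<Rightarrow> 'b::euclidean_space"
  assumes S: "open S" "p \<in> S"
    and D: "\<And>q. q \<in> S \<Longrightarrow> (f has_derivative D q) (at q)"
    and D2: "\<And>v. ((\<lambda>q. D q v) has_derivative (\<lambda>w. D2 w v)) (at p)"
  shows "D2 u v = D2 v u"
proof (rule euclidean_eqI)
  fix b :: 'b
  let ?f = "\<lambda>q. f q \<bullet> b"
  have 1: "(?f has_derivative (\<lambda>v. D q v \<bullet> b)) (at q)" if "q \<in> S" for q
    by (intro has_derivative_inner_left D that)
  have 2: "((\<lambda>q. D q v \<bullet> b) has_derivative (\<lambda>w. D2 w v \<bullet> b)) (at p)" for v
    by (intro has_derivative_inner_left D2)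
  have 3: "((\<lambda>t. (?f (p + t *\<^sub>R u + t *\<^sub>R v) - ?f (p + t *\<^sub>R u) - ?f (p + t *\<^sub>R v) + ?f p) / t\<^sup>2)
    \<longlongrightarrow> D2 v u \<bullet> b) (at_right 0)"
    by (rule second_difference_quotient[OF S 1 2])
  have "((\<lambda>t. (?f (p + t *\<^sub>R v + t *\<^sub>R u) - ?f (p + t *\<^sub>R v) - ?f (p + t *\<^sub>R u) + ?f p) / t\<^sup>2)
    \<longlongrightarrow> D2 u v \<bullet> b) (at_right 0)"
    by (rule second_difference_quotient[OF S 1 2])
  moreover have "(?f (p + t *\<^sub>R v + t *\<^sub>R u) - ?f (p + t *\<^sub>R v) - ?f (p + t *\<^sub>R u) + ?f p) / t\<^sup>2
     = (?f (p + t *\<^sub>R u + t *\<^sub>R v) - ?f (p + t *\<^sub>R u) - ?f (p + t *\<^sub>R v) + ?f p) / t\<^sup>2" for t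
    by (simp add: add.assoc add.commute[of "t *\<^sub>R v"])
  ultimately show "D2 u v \<bullet> b = D2 v u \<bullet> b"
    using tendsto_unique[OF _ 3] by simp
qed

section \<open>Product rules for point-dependent linear and bilinear maps\<close>

lemma linear_Basis_expand:
  fixes A :: "'a::euclidean_space \<Rightarrow> 'b::real_vector"
  assumes "linear A"
  shows "A u = (\<Sum>b\<in>Basis. (u \<bullet> b) *\<^sub>R A b)"
  using linear_sum[OF assms, of "\<lambda>b. (u \<bullet> b) *\<^sub>R b" Basis]
  by (simp add: euclidean_representation linear_scale[OF assms])

text \<open>Derivatives of \<open>A\<close> are given at fixed vectors only, so the moving vector is
  expanded over \<open>Basis\<close>, which leaves a finite sum of scalar functions times such
  maps.\<close>

lemma has_derivative_moving_linear:
  fixes A :: "'p::real_normed_vector \<Rightarrow> 'a::euclidean_space \<Rightarrow> 'b::real_normed_vector"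
  assumes S: "open S" "P t \<in> S" and lin: "\<And>q. q \<in> S \<Longrightarrow> linear (A q)"
    and dA: "\<And>b. ((\<lambda>q. A q b) has_derivative (\<lambda>w. dA w b)) (at (P t))"
    and P: "(P has_derivative P') (at t)" and U: "(U has_derivative U') (at t)"
  shows "((\<lambda>s. A (P s) (U s)) has_derivative (\<lambda>h. dA (P' h) (U t) + A (P t) (U' h))) (at t)"
proof -
  have expand: "A q u = (\<Sum>b\<in>Basis. (u \<bullet> b) *\<^sub>R A q b)" if "q \<in> S" for q u
    by (rule linear_Basis_expand[OF lin[OF that]])
  have "((\<lambda>q. \<Sum>b\<in>Basis. (u \<bullet> b) *\<^sub>R A q b) has_derivative (\<lambda>w. \<Sum>b\<in>Basis. (u \<bullet> b) *\<^sub>R dA w b)) (at (P t))" for u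
    by (rule has_derivative_sum[OF has_derivative_scaleR_right[OF dA]])
  then have "((\<lambda>q. A q u) has_derivative (\<lambda>w. \<Sum>b\<in>Basis. (u \<bullet> b) *\<^sub>R dA w b)) (at (P t))" for u
    by (rule has_derivative_transform_within_open[OF _ S]) (simp add: expand)
  \<comment> \<open>\<open>dA w\<close> inherits linearity from \<open>A q\<close> by uniqueness of
    derivatives.\<close>
  then have dexpand: "dA w u = (\<Sum>b\<in>Basis. (u \<bullet> b) *\<^sub>R dA w b)" for w u
    using fun_cong[OF has_derivative_unique[OF dA]] by blast
  have "((\<lambda>s. \<Sum>b\<in>Basis. (U s \<bullet> b) *\<^sub>R A (P s) b) has_derivative
      (\<lambda>h. \<Sum>b\<in>Basis. (U t \<bullet> b) *\<^sub>R dA (P' h) b + (U' h \<bullet> b) *\<^sub>R A (P t) b)) (at t)"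
    by (rule has_derivative_sum[OF has_derivative_scaleR[OF has_derivative_inner_left[OF U]
        has_derivative_compose[OF P dA]]])
  then have E: "((\<lambda>s. \<Sum>b\<in>Basis. (U s \<bullet> b) *\<^sub>R A (P s) b) has_derivative
      (\<lambda>h. dA (P' h) (U t) + A (P t) (U' h))) (at t)"
    by (simp add: sum.distrib dexpand[of _ "U t"] expand[OF S(2), of "U' _"])
  \<comment> \<open>The expansion is valid only while \<open>P s\<close> lies in \<open>S\<close>,
    hence on a neighbourhood of t, by continuity of \<open>P\<close>.\<close>
  have "\<forall>\<^sub>F s in nhds t. P s \<in> S"
    using P S has_derivative_continuous[OF P]
    by (metis (mono_tags, lifting) continuous_at_open eventually_nhds)
  then obtain T where T: "open T" "t \<in> T" "\<And>s. s \<in> T \<Longrightarrow> P s \<in> S"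
    unfolding eventually_nhds by blast
  have "(\<Sum>b\<in>Basis. (U s \<bullet> b) *\<^sub>R A (P s) b) = A (P s) (U s)" if "s \<in> T" for s
    by (rule expand[OF T(3)[OF that], symmetric])
  then show ?thesis
    by (rule has_derivative_transform_within_open[OF E T(1,2)])
qed

text \<open>The linear case is used twice: first to differentiate jointly in the base point and the
  first argument, then with that pair as the base point and the second argument moving.\<close>

lemma has_derivative_moving_bilinear:
  fixes A :: "'p::real_normed_vector \<Rightarrow> 'a::euclidean_space \<Rightarrow> 'c::euclidean_space \<Rightarrow> 'b::real_normed_vector"
  assumes S: "open S" "P t \<in> S" and lin: "\<And>q. q \<in> S \<Longrightarrow> bilinear (A q)"
    and dA: "\<And>u v. ((\<lambda>q. A q u v) has_derivative (\<lambda>w. dA w u v)) (at (P t))"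
    and P: "(P has_derivative P') (at t)" and U: "(U has_derivative U') (at t)"
    and V: "(V has_derivative V') (at t)"
  shows "((\<lambda>s. A (P s) (U s) (V s)) has_derivative
    (\<lambda>h. dA (P' h) (U t) (V t) + A (P t) (U' h) (V t) + A (P t) (U t) (V' h))) (at t)"
proof -
  have 1: "((\<lambda>s. (P s, U s)) has_derivative (\<lambda>h. (P' h, U' h))) (at t)"
    by (intro has_derivative_Pair P U)
  have 2: "((\<lambda>z. A (fst z) (snd z) v) has_derivative
      (\<lambda>h. dA (fst h) (U t) v + A (P t) (snd h) v)) (at (P t, U t))" for v
    using has_derivative_moving_linear[where P = fst and U = snd and t = "(P t, U t)" and A = "\<lambda>q u. A q u v",
        OF S(1) _ _ _ has_derivative_fst[OF has_derivative_ident] has_derivative_snd[OF has_derivative_ident], of "\<lambda>w u. dA w u v"]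
      S dA lin by (simp add: bilinear_def)
  have "open (S \<times> (UNIV :: 'a set))" using S by (simp add: open_Times)
  from has_derivative_moving_linear[where P = "\<lambda>s. (P s, U s)" and A = "\<lambda>z. A (fst z) (snd z)",
      OF this _ _ _ 1 V, of "\<lambda>h v. dA (fst h) (U t) v + A (P t) (snd h) v"]
  show ?thesis using S lin 2 by (auto simp add: bilinear_def)
qed

section \<open>Levi-Civita connections and the derivatives of isometries\<close>

text \<open>\<open>\<Gamma>_sym\<close> (no torsion) and \<open>metric_compatible\<close>
  characterise the Levi-Civita connection, so an explicit \<Gamma> with these two properties
  replaces the Koszul formula.\<close>

locale connection_geometry =
  fixes S :: "'a::euclidean_space set" and g :: "'a \<Rightarrow> 'a \<Rightarrow> 'a \<Rightarrow> real"
    and \<Gamma> :: "'a \<Rightarrow> 'a \<Rightarrow> 'a \<Rightarrow> 'a" and d\<Gamma> :: "'a \<Rightarrow> 'a \<Rightarrow> 'a \<Rightarrow> 'a \<Rightarrow> 'a"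
  assumes open_S: "open S"
    and g_bilinear: "p \<in> S \<Longrightarrow> bilinear (g p)"
    and g_sym: "p \<in> S \<Longrightarrow> g p u v = g p v u"
    and g_pos: "p \<in> S \<Longrightarrow> u \<noteq> 0 \<Longrightarrow> g p u u > 0"
    and \<Gamma>_bilinear: "p \<in> S \<Longrightarrow> bilinear (\<Gamma> p)"
    and \<Gamma>_sym: "p \<in> S \<Longrightarrow> \<Gamma> p u v = \<Gamma> p v u"
    and metric_compatible:
      "p \<in> S \<Longrightarrow> ((\<lambda>q. g q u v) has_derivative (\<lambda>w. g p (\<Gamma> p w u) v + g p u (\<Gamma> p w v))) (at p)"
    and \<Gamma>_derivative: "p \<in> S \<Longrightarrow> ((\<lambda>q. \<Gamma> q u v) has_derivative (\<lambda>w. d\<Gamma> p w u v)) (at p)"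
begin

text \<open>Sign convention: R(w, u) v = nabla_w nabla_u v - nabla_u nabla_w v for constant
  fields.\<close>

definition curvature :: "'a \<Rightarrow> 'a \<Rightarrow> 'a \<Rightarrow> 'a \<Rightarrow> 'a" where
  "curvature p w u v = d\<Gamma> p w u v - d\<Gamma> p u w v + \<Gamma> p w (\<Gamma> p u v) - \<Gamma> p u (\<Gamma> p w v)"

end

text \<open>
  \<open>D p v\<close>, \<open>D2 p w v\<close> and \<open>D3 p x w v\<close> are the derivatives of \<open>\<phi>\<close> at \<open>p\<close>; the outermost
  differentiation is in the direction given first.
\<close>

locale isometry_jet = connection_geometry +
  fixes \<phi> :: "'a \<Rightarrow> 'a" and D :: "'a \<Rightarrow> 'a \<Rightarrow> 'a" and D2 :: "'a \<Rightarrow> 'a \<Rightarrow> 'a \<Rightarrow> 'a"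
    and D3 :: "'a \<Rightarrow> 'a \<Rightarrow> 'a \<Rightarrow> 'a \<Rightarrow> 'a"
  assumes maps: "p \<in> S \<Longrightarrow> \<phi> p \<in> S"
    and D: "p \<in> S \<Longrightarrow> (\<phi> has_derivative D p) (at p)"
    and D2: "p \<in> S \<Longrightarrow> ((\<lambda>q. D q v) has_derivative (\<lambda>w. D2 p w v)) (at p)"
    and D3: "p \<in> S \<Longrightarrow> ((\<lambda>q. D2 q u v) has_derivative (\<lambda>w. D3 p w u v)) (at p)"
    and isometric: "p \<in> S \<Longrightarrow> g (\<phi> p) (D p u) (D p v) = g p u v"
begin

lemma linear_D: "p \<in> S \<Longrightarrow> linear (D p)"
  using D has_derivative_linear by blast

lemma D2_sym: "p \<in> S \<Longrightarrow> D2 p u v = D2 p v u"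
  by (rule symmetric_second_derivative[OF open_S _ D D2])

lemma D3_sym: "p \<in> S \<Longrightarrow> D3 p u w v = D3 p w u v"
  by (rule symmetric_second_derivative[OF open_S _ D2 D3])

lemma inj_D: assumes "p \<in> S" shows "inj (D p)"
proof -
  have "u = 0" if "D p u = 0" for u
  proof (rule ccontr)
    assume "u \<noteq> 0"
    then have "g (\<phi> p) (D p u) (D p u) > 0" using isometric g_pos assms by simp
    then show False using that bilinear_lzero[OF g_bilinear[OF maps[OF assms]], of 0] by simp
  qed
  then show ?thesis using linear_injective_0[OF linear_D[OF assms]] by simp
qed

lemma surj_D: "p \<in> S \<Longrightarrow> surj (D p)"
  using linear_inj_imp_surj[OF linear_D inj_D] .

text \<open>An isometry is affine for the Levi-Civita connection. The defect \<open>T\<close> is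
  symmetric because second derivatives and both connections are; differentiating
  \<open>isometric\<close> makes \<open>T w\<close> skew for the metric, and the two symmetries
  together force \<open>T\<close> to vanish.\<close>

lemma second_derivative_eq:
  assumes p: "p \<in> S"
  shows "D2 p w u = D p (\<Gamma> p w u) - \<Gamma> (\<phi> p) (D p w) (D p u)"
proof -
  let ?g = "g (\<phi> p)"
  note gb = g_bilinear[OF maps[OF p]]
  define T where "T w u = D2 p w u + \<Gamma> (\<phi> p) (D p w) (D p u) - D p (\<Gamma> p w u)" for w u
  have T_sym: "T w u = T u w" for w u
    by (simp add: T_def D2_sym[OF p, of w u] \<Gamma>_sym[OF maps[OF p], of "D p w"] \<Gamma>_sym[OF p, of w u])
  have anti: "?g (T w u) (D p v) + ?g (D p u) (T w v) = 0" for w u v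
  proof -
    have "((\<lambda>q. g (\<phi> q) (D q u) (D q v)) has_derivative
      (\<lambda>w. ?g (\<Gamma> (\<phi> p) (D p w) (D p u)) (D p v) + ?g (D p u) (\<Gamma> (\<phi> p) (D p w) (D p v))
         + ?g (D2 p w u) (D p v) + ?g (D p u) (D2 p w v))) (at p)"
      by (rule has_derivative_moving_bilinear[OF open_S maps[OF p] g_bilinear metric_compatible[OF maps[OF p]] D[OF p] D2[OF p] D2[OF p]])
    then have 1: "((\<lambda>q. g q u v) has_derivative
      (\<lambda>w. ?g (\<Gamma> (\<phi> p) (D p w) (D p u)) (D p v) + ?g (D p u) (\<Gamma> (\<phi> p) (D p w) (D p v))
         + ?g (D2 p w u) (D p v) + ?g (D p u) (D2 p w v))) (at p)"
      by (rule has_derivative_transform_within_open[OF _ open_S p]) (rule isometric)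
    have "?g (\<Gamma> (\<phi> p) (D p w) (D p u)) (D p v) + ?g (D p u) (\<Gamma> (\<phi> p) (D p w) (D p v))
         + ?g (D2 p w u) (D p v) + ?g (D p u) (D2 p w v) = ?g (D p (\<Gamma> p w u)) (D p v) + ?g (D p u) (D p (\<Gamma> p w v))"
      using fun_cong[OF has_derivative_unique[OF 1 metric_compatible[OF p]], of w] by (simp add: isometric[OF p])
    then show ?thesis
      by (simp add: T_def bilinear_lsub[OF gb] bilinear_rsub[OF gb] bilinear_ladd[OF gb] bilinear_radd[OF gb])
  qed
  define t where "t w u v = ?g (T w u) (D p v)" for w u v
  have a: "t w u v = - t w v u" for w u v
    using anti[of w u v] g_sym[OF maps[OF p], of "D p u"] by (simp add: t_def)
  have s: "t w u v = t u w v" for w u v by (simp add: t_def T_sym[of w])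
  have "t w u v = 0" for w u v
  \<comment> \<open>a trilinear form symmetric in two adjacent slots and alternating in the other two vanishes\<close>
    using a[of w u v] s[of w v u] a[of v w u] s[of v u w] a[of u v w] s[of u w v] by linarith
  \<comment> \<open>Surjectivity of \<open>D p\<close> allows testing the form against
    \<open>T w u\<close> itself.\<close>
  moreover obtain v where "T w u = D p v" using surj_D[OF p] by (metis surjD)
  ultimately have "?g (T w u) (T w u) = 0" unfolding t_def by metis
  then have "T w u = 0" using g_pos[OF maps[OF p], of "T w u"] by (metis less_irrefl)
  then show ?thesis by (simp add: T_def algebra_simps)
qed

text \<open>Differentiating \<open>second_derivative_eq\<close> expresses \<open>D3\<close>, and
  \<open>D3_sym\<close> equates the expressions with w and u exchanged. After the second derivatives
  are eliminated by the same law, the terms symmetric in w and u cancel and the curvatures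
  remain.\<close>

lemma curvature_invariant:
  assumes p: "p \<in> S"
  shows "curvature (\<phi> p) (D p w) (D p u) (D p v) = D p (curvature p w u v)"
proof -
  note gl = bilinear_lsub[OF \<Gamma>_bilinear[OF maps[OF p]]] bilinear_rsub[OF \<Gamma>_bilinear[OF maps[OF p]]]
  note Dl = linear_add[OF linear_D[OF p]] linear_diff[OF linear_D[OF p]]
  have third: "D3 p w u v = D2 p w (\<Gamma> p u v) + D p (d\<Gamma> p w u v) -
      (d\<Gamma> (\<phi> p) (D p w) (D p u) (D p v) + \<Gamma> (\<phi> p) (D2 p w u) (D p v) + \<Gamma> (\<phi> p) (D p u) (D2 p w v))" for w u v
  proof -
    have "((\<lambda>q. D q (\<Gamma> q u v) - \<Gamma> (\<phi> q) (D q u) (D q v)) has_derivative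
      (\<lambda>w. D2 p w (\<Gamma> p u v) + D p (d\<Gamma> p w u v) -
        (d\<Gamma> (\<phi> p) (D p w) (D p u) (D p v) + \<Gamma> (\<phi> p) (D2 p w u) (D p v) + \<Gamma> (\<phi> p) (D p u) (D2 p w v)))) (at p)"
      by (intro has_derivative_diff has_derivative_moving_linear[OF open_S p linear_D D2[OF p] has_derivative_ident \<Gamma>_derivative[OF p]]
         has_derivative_moving_bilinear[OF open_S maps[OF p] \<Gamma>_bilinear \<Gamma>_derivative[OF maps[OF p]] D[OF p] D2[OF p] D2[OF p]])
    then have "((\<lambda>q. D2 q u v) has_derivative
      (\<lambda>w. D2 p w (\<Gamma> p u v) + D p (d\<Gamma> p w u v) -
        (d\<Gamma> (\<phi> p) (D p w) (D p u) (D p v) + \<Gamma> (\<phi> p) (D2 p w u) (D p v) + \<Gamma> (\<phi> p) (D p u) (D2 p w v)))) (at p)"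
      by (rule has_derivative_transform_within_open[OF _ open_S p]) (simp add: second_derivative_eq)
    from fun_cong[OF has_derivative_unique[OF D3[OF p] this]] show ?thesis .
  qed
  show ?thesis
    using D3_sym[OF p, of w u v] unfolding third[of w] third[of u]
    by (simp add: curvature_def second_derivative_eq[OF p] gl Dl \<Gamma>_sym[OF p, of w u]
       \<Gamma>_sym[OF maps[OF p], of "D p w" "D p u"] algebra_simps)
qed

end

section \<open>Trace and Ricci tensor\<close>

definition linear_trace :: "('a::euclidean_space \<Rightarrow> 'a) \<Rightarrow> real" where
  "linear_trace A = (\<Sum>b\<in>Basis. A b \<bullet> b)"

lemma linear_trace_comp_commute:
  fixes A B :: "'a::euclidean_space \<Rightarrow> 'a"
  assumes "linear A" "linear B"
  shows "linear_trace (A \<circ> B) = linear_trace (B \<circ> A)"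
proof -
  have *: "linear_trace (A \<circ> B) = (\<Sum>b\<in>Basis. \<Sum>c\<in>Basis. (B b \<bullet> c) * (A c \<bullet> b))" if "linear A" for A B :: "'a \<Rightarrow> 'a"
    unfolding linear_trace_def comp_def by (subst linear_Basis_expand[OF that, of "B _"]) (simp add: inner_sum_left)
  show ?thesis unfolding *[OF assms(1)] *[OF assms(2)]
    by (subst sum.swap) (simp add: mult.commute)
qed

context connection_geometry
begin

definition Ricci :: "'a \<Rightarrow> 'a \<Rightarrow> 'a \<Rightarrow> real" where
  "Ricci p w v = linear_trace (\<lambda>u. curvature p u w v)"

end

text \<open>By \<open>curvature_invariant\<close> the endomorphisms traced at p and at its image are
  conjugate under \<open>D p\<close>, and conjugate endomorphisms have equal trace.\<close>

lemma (in isometry_jet) Ricci_invariant: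
  assumes p: "p \<in> S" and lin: "linear (\<lambda>u. curvature p u w v)"
  shows "Ricci (\<phi> p) (D p w) (D p v) = Ricci p w v"
proof -
  obtain E where E: "linear E" "\<And>x. E (D p x) = x" "\<And>x. D p (E x) = x"
    using linear_injective_isomorphism[OF linear_D[OF p] inj_D[OF p]] by blast
  let ?R = "\<lambda>u. curvature p u w v"
  have "(\<lambda>u. curvature (\<phi> p) u (D p w) (D p v)) = D p \<circ> (?R \<circ> E)"
    using curvature_invariant[OF p, of "E _" w v] by (auto simp: E)
  then have "Ricci (\<phi> p) (D p w) (D p v) = linear_trace (D p \<circ> (?R \<circ> E))" by (simp add: Ricci_def)
  also have "\<dots> = linear_trace ((?R \<circ> E) \<circ> D p)"
    using linear_trace_comp_commute[OF linear_D[OF p] linear_compose[OF E(1) lin]] .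
  also have "(?R \<circ> E) \<circ> D p = ?R" by (auto simp: E)
  finally show ?thesis by (simp add: Ricci_def)
qed

section \<open>The metric on \<open>\<H> \<times> \<complex>\<close>\<close>

definition slope :: "complex \<times> complex \<Rightarrow> real" where
  "slope p = Im (snd p) / Im (fst p)"

text \<open>
  The form \<open>dz - (v/y) d\<tau>\<close>; its kernel is the orthogonal complement of the fibres of \<open>\<tau>\<close>. The
  tensors below are written in the coframe \<^const>\<open>fst\<close>, \<open>vert p\<close>.
\<close>

definition vert :: "complex \<times> complex \<Rightarrow> complex \<times> complex \<Rightarrow> complex" where
  "vert p u = snd u - of_real (slope p) * fst u"

definition gHC :: "complex \<times> complex \<Rightarrow> complex \<times> complex \<Rightarrow> complex \<times> complex \<Rightarrow> real" where
  "gHC p u v = (fst u \<bullet> fst v) / (2 * (Im (fst p))\<^sup>2) + (vert p u \<bullet> vert p v) / (2 * Im (fst p))"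

text \<open>
  Since the metric is Kaehler, its Christoffel symbols are complex bilinear.
\<close>

definition christoffel_fst :: "complex \<times> complex \<Rightarrow> complex \<times> complex \<Rightarrow> complex \<times> complex \<Rightarrow> complex" where
  "christoffel_fst p w u = \<i> * fst w * fst u / of_real (Im (fst p)) + \<i> / 2 * vert p w * vert p u"

definition christoffel_vert :: "complex \<times> complex \<Rightarrow> complex \<times> complex \<Rightarrow> complex \<times> complex \<Rightarrow> complex" where
  "christoffel_vert p w u = \<i> * (fst w * vert p u + vert p w * fst u) / (2 * of_real (Im (fst p)))"

definition christoffel :: "complex \<times> complex \<Rightarrow> complex \<times> complex \<Rightarrow> complex \<times> complex \<Rightarrow> complex \<times> complex" where
  "christoffel p w u = (christoffel_fst p w u, christoffel_vert p w u + of_real (slope p) * christoffel_fst p w u)"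

definition d_christoffel_fst where
  "d_christoffel_fst p w u v = - \<i> * of_real (Im (fst w)) * fst u * fst v / (of_real (Im (fst p)))\<^sup>2
     - \<i> / 2 * of_real (Im (vert p w) / Im (fst p)) * (fst u * vert p v + vert p u * fst v)"

text \<open>This is \<open>vert p\<close>, with p frozen, of the derivative of
  \<open>christoffel\<close>. It exceeds the derivative of \<open>christoffel_vert\<close> by
  d(slope) times \<open>christoffel_fst\<close>, because the coframe moves with p.\<close>

definition d_christoffel_vert where
  "d_christoffel_vert p w u v = - \<i> * of_real (Im (fst w)) * (fst u * vert p v + vert p u * fst v) / (2 * (of_real (Im (fst p)))\<^sup>2)
     + \<i> / 2 * of_real (Im (vert p w) / Im (fst p)) * vert p u * vert p v"

definition d_christoffel :: "complex \<times> complex \<Rightarrow> complex \<times> complex \<Rightarrow> complex \<times> complex \<Rightarrow> complex \<times> complex \<Rightarrow> complex \<times> complex" where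
  "d_christoffel p w u v = (d_christoffel_fst p w u v, d_christoffel_vert p w u v + of_real (slope p) * d_christoffel_fst p w u v)"

section \<open>Levi-Civita connection and Ricci tensor of \<open>gHC\<close>\<close>

lemma HC_iff: "p \<in> HC \<longleftrightarrow> Im (fst p) > 0"
  by (cases p) (simp add: HC_def)

lemma open_HC: "open HC"
  unfolding HC_def by (intro open_Times open_UNIV open_halfspace_Im_gt)

lemma convex_HC: "convex HC"
  unfolding HC_def by (intro convex_Times convex_halfspace_Im_gt convex_UNIV)

lemma fst_of_christoffel [simp]: "fst (christoffel p w u) = christoffel_fst p w u"
  and vert_of_christoffel [simp]: "vert p (christoffel p w u) = christoffel_vert p w u"
  by (simp_all add: christoffel_def vert_def)

lemma vert_add: "vert p (u + v) = vert p u + vert p v"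
  and vert_diff: "vert p (u - v) = vert p u - vert p v"
  and vert_scaleR: "vert p (r *\<^sub>R u) = r *\<^sub>R vert p u"
  by (simp_all add: vert_def algebra_simps scaleR_conv_of_real)

lemma pair_eq_vert: "u = v \<longleftrightarrow> fst u = fst v \<and> vert p u = vert p v"
  by (auto simp: vert_def prod_eq_iff)

lemma bilinear_gHC: "bilinear (gHC p)"
  unfolding bilinear_def by (intro conjI allI linearI)
    (simp_all add: gHC_def vert_add vert_scaleR inner_add_left inner_add_right add_divide_distrib ring_distribs)

lemma bilinear_christoffel: "bilinear (christoffel p)"
  unfolding bilinear_def by (intro conjI allI linearI)
    (simp_all add: pair_eq_vert[of _ _ p] vert_add vert_scaleR christoffel_fst_def christoffel_vert_def add_divide_distrib algebra_simps scaleR_conv_of_real)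

lemma christoffel_sym: "christoffel p w u = christoffel p u w"
  by (simp add: christoffel_def christoffel_fst_def christoffel_vert_def algebra_simps)

text \<open>d(v/y) = (dv - (v/y) dy) / y, and the numerator is the imaginary part of
  \<open>vert p w\<close> since the slope is real.\<close>

lemma has_derivative_slope:
  assumes "p \<in> HC"
  shows "(slope has_derivative (\<lambda>w. Im (vert p w) / Im (fst p))) (at p)"
proof -
  have y: "Im (fst p) \<noteq> 0" using assms by (simp add: HC_iff)
  show ?thesis unfolding slope_def[abs_def] vert_def using y
    by (auto intro!: derivative_eq_intros simp: slope_def fun_eq_iff field_simps)
qed

lemma has_derivative_vert:
  assumes "p \<in> HC"
  shows "((\<lambda>q. vert q u) has_derivative (\<lambda>w. - of_real (Im (vert p w) / Im (fst p)) * fst u)) (at p)"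
  unfolding vert_def[of _ u] by (auto intro!: derivative_eq_intros has_derivative_slope[OF assms])

lemma gHC_compatible:
  assumes "p \<in> HC"
  shows "((\<lambda>q. gHC q u v) has_derivative (\<lambda>w. gHC p (christoffel p w u) v + gHC p u (christoffel p w v))) (at p)"
proof -
  have y: "Im (fst p) \<noteq> 0" using assms by (simp add: HC_iff)
  show ?thesis unfolding gHC_def[of _ u v]
    apply (rule derivative_eq_intros has_derivative_vert[OF assms] refl | use y in force)+
    using y apply (simp add: fun_eq_iff gHC_def christoffel_fst_def christoffel_vert_def inner_complex_def)
    apply (simp add: field_simps power2_eq_square)
    done
qed

lemma has_derivative_christoffel:
  assumes "p \<in> HC"
  shows "((\<lambda>q. christoffel q u v) has_derivative (\<lambda>w. d_christoffel p w u v)) (at p)"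
proof -
  have y: "complex_of_real (Im (fst p)) \<noteq> 0" using assms by (simp add: HC_iff)
  have 1: "((\<lambda>q. christoffel_fst q u v) has_derivative (\<lambda>w. d_christoffel_fst p w u v)) (at p)"
    unfolding christoffel_fst_def[of _ u v]
    apply (rule derivative_eq_intros has_derivative_vert[OF assms] refl | use y in force)+
    using y apply (simp add: fun_eq_iff d_christoffel_fst_def)
    apply (simp add: field_simps power2_eq_square)
    done
  have 2: "((\<lambda>q. christoffel_vert q u v) has_derivative (\<lambda>w. d_christoffel_vert p w u v - of_real (Im (vert p w) / Im (fst p)) * christoffel_fst p u v)) (at p)"
    unfolding christoffel_vert_def[of _ u v]
    apply (rule derivative_eq_intros has_derivative_vert[OF assms] refl | use y in force)+
    using y apply (simp add: fun_eq_iff d_christoffel_vert_def christoffel_fst_def)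
    apply (simp add: field_simps power2_eq_square)
    done
  show ?thesis unfolding christoffel_def[of _ u v]
    apply (rule derivative_eq_intros has_derivative_slope[OF assms] 1 2 refl)+
    by (simp add: fun_eq_iff d_christoffel_def)
qed

lemma gHC_pos:
  assumes "p \<in> HC" "u \<noteq> 0"
  shows "gHC p u u > 0"
proof -
  have "fst u \<noteq> 0 \<or> vert p u \<noteq> 0" using assms(2) by (auto simp: vert_def prod_eq_iff)
  then show ?thesis using assms(1) unfolding gHC_def HC_iff
    by (cases "fst u = 0") (simp_all add: add_pos_nonneg)
qed

interpretation HC: connection_geometry HC gHC christoffel d_christoffel
  using open_HC bilinear_gHC gHC_pos bilinear_christoffel christoffel_sym gHC_compatible has_derivative_christoffel
  by unfold_locales (auto simp: gHC_def inner_commute)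

lemma linear_curvature: "linear (\<lambda>u. HC.curvature p u w v)"
  unfolding HC.curvature_def
  by (rule linearI) (simp_all add: pair_eq_vert[of _ _ p] vert_add vert_scaleR vert_diff christoffel_fst_def christoffel_vert_def d_christoffel_def d_christoffel_fst_def d_christoffel_vert_def
    add_divide_distrib diff_divide_distrib algebra_simps scaleR_conv_of_real)

lemma linear_trace_complex_prod:
  fixes A :: "complex \<times> complex \<Rightarrow> complex \<times> complex"
  shows "linear_trace A = Re (fst (A (1, 0))) + Im (fst (A (\<i>, 0))) + Re (snd (A (0, 1))) + Im (snd (A (0, \<i>)))"
  unfolding linear_trace_def Basis_prod_def
  by (subst sum.union_disjoint) (auto simp: Basis_complex_def sum.reindex inj_on_def inner_complex_def inner_prod_def)

text \<open>A direct computation of the trace. Its value lies in the degeneracy: the null vectors of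
  the Ricci tensor are exactly the vertical ones, so isometries must respect the fibres of
  \<tau>.\<close>

lemma Ricci_HC:
  assumes "p \<in> HC"
  shows "HC.Ricci p w v = - 3 / 2 * (fst w \<bullet> fst v) / (Im (fst p))\<^sup>2"
proof -
  \<comment> \<open>Writing y as \<open>1 / k\<close> leaves only polynomial identities in k to
    check.\<close>
  define k where "k = 1 / Im (fst p)"
  have k: "complex_of_real (Im (fst p)) = 1 / of_real k" "Im (fst p) = 1 / k" by (simp_all add: k_def)
  have vb: "vert p (a, b) = b - of_real (slope p) * a" for a b by (simp add: vert_def)
  show ?thesis
    unfolding HC.Ricci_def linear_trace_complex_prod HC.curvature_def
    apply (simp add: christoffel_def d_christoffel_def vert_diff vert_add)
    apply (simp add: christoffel_def d_christoffel_def vb vert_diff vert_add d_christoffel_fst_def d_christoffel_vert_def christoffel_fst_def christoffel_vert_def k)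
    apply (simp add: inner_complex_def power2_eq_square)
    apply (simp add: algebra_simps add_divide_distrib diff_divide_distrib)
    done
qed

section \<open>Isometries of \<open>\<H> \<times> \<complex>\<close>\<close>

text \<open>With Q = Im F / y the equation gives dQ = (Q dy - Q dy) / y = 0, so Q is a constant l.
  Then F - l \<tau> is constant too, and it is real because Im F = l y.\<close>

lemma affine_of_derivative:
  assumes F: "\<And>p. p \<in> HC \<Longrightarrow> (F has_derivative (\<lambda>w. of_real (Im (F p) / Im (fst p)) * fst w)) (at p)"
  shows "\<exists>l m. \<forall>p\<in>HC. F p = of_real l * fst p + of_real m"
proof -
  define Q where "Q p = Im (F p) / Im (fst p)" for p :: "complex \<times> complex"
  have "(Q has_derivative (\<lambda>w. 0)) (at p within HC)" if "p \<in> HC" for p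
  proof -
    have y: "Im (fst p) \<noteq> 0" using that by (simp add: HC_iff)
    have "(Q has_derivative (\<lambda>w. 0)) (at p)" unfolding Q_def using y
      by (auto intro!: derivative_eq_intros F[OF that] simp: fun_eq_iff field_simps)
    then show ?thesis by (rule has_derivative_at_withinI)
  qed
  then obtain l where l: "\<And>p. p \<in> HC \<Longrightarrow> Q p = l"
    using has_derivative_zero_constant[OF convex_HC, of Q] by blast
  define R where "R p = F p - of_real l * fst p" for p :: "complex \<times> complex"
  have "(R has_derivative (\<lambda>w. 0)) (at p within HC)" if "p \<in> HC" for p
  proof -
    have "(R has_derivative (\<lambda>w. 0)) (at p)" unfolding R_def
      by (auto intro!: derivative_eq_intros F[OF that] simp: fun_eq_iff l[OF that, unfolded Q_def] simp flip: of_real_divide)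
    then show ?thesis by (rule has_derivative_at_withinI)
  qed
  then obtain m where m: "\<And>p. p \<in> HC \<Longrightarrow> R p = m"
    using has_derivative_zero_constant[OF convex_HC, of R] by blast
  have "Im m = 0"
    using m[of "(\<i>, 0)"] l[of "(\<i>, 0)"] by (auto simp: HC_iff R_def Q_def)
  then have "F p = of_real l * fst p + of_real (Re m)" if "p \<in> HC" for p
    using m[OF that] by (auto simp: R_def complex_eq_iff)
  then show ?thesis by blast
qed

section \<open>First-order form of an isometry\<close>

locale HC_isometry = isometry_jet HC gHC christoffel d_christoffel \<psi> D D2 D3 for \<psi> D D2 D3
begin

lemma Im_fst: "p \<in> HC \<Longrightarrow> Im (fst p) > 0" "p \<in> HC \<Longrightarrow> Im (fst (\<psi> p)) > 0"
  using maps[of p] by (simp_all add: HC_iff)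

lemma fst_D_inner:
  assumes p: "p \<in> HC"
  shows "(fst (D p w) \<bullet> fst (D p v)) / (Im (fst (\<psi> p)))\<^sup>2 = (fst w \<bullet> fst v) / (Im (fst p))\<^sup>2"
  using Ricci_invariant[OF p linear_curvature, of w v] Im_fst[OF p]
  unfolding Ricci_HC[OF p] Ricci_HC[OF maps[OF p]] by (simp add: field_simps)

lemma vert_D_inner:
  assumes p: "p \<in> HC"
  shows "(vert (\<psi> p) (D p w) \<bullet> vert (\<psi> p) (D p v)) / Im (fst (\<psi> p)) = (vert p w \<bullet> vert p v) / Im (fst p)"
proof -
  have "(fst (D p w) \<bullet> fst (D p v)) / (2 * (Im (fst (\<psi> p)))\<^sup>2) = (fst w \<bullet> fst v) / (2 * (Im (fst p))\<^sup>2)"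
    using fst_D_inner[OF p, of w v] Im_fst[OF p] by (simp add: field_simps)
  then show ?thesis
    using isometric[OF p, of w v] Im_fst[OF p] unfolding gHC_def by (simp add: field_simps)
qed

text \<open>Take v = w in \<open>fst_D_inner\<close>: \<open>D p\<close> maps vertical vectors to
  vertical vectors.\<close>

lemma fst_D_eq_0: "p \<in> HC \<Longrightarrow> fst w = 0 \<Longrightarrow> fst (D p w) = 0"
  using fst_D_inner[of p w w] Im_fst[of p] by simp

lemma vert_D_eq_0: "p \<in> HC \<Longrightarrow> vert p w = 0 \<Longrightarrow> vert (\<psi> p) (D p w) = 0"
  using vert_D_inner[of p w w] Im_fst[of p] by simp

lemma fst_D2_eq_0: assumes p: "p \<in> HC" and v: "fst v = 0" shows "fst (D2 p w v) = 0"
proof -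
  have "((\<lambda>q. fst (D q v)) has_derivative (\<lambda>w. fst (D2 p w v))) (at p)"
    by (rule has_derivative_fst[OF D2[OF p]])
  moreover have "((\<lambda>q. fst (D q v)) has_derivative (\<lambda>w. 0)) (at p)"
    by (rule has_derivative_transform_within_open[OF has_derivative_const open_HC p])
      (simp add: fst_D_eq_0 v)
  ultimately show ?thesis using has_derivative_unique by metis
qed

text \<open>The first component of \<open>second_derivative_eq\<close> in the directions (0, b), (0,
  b). Its left side vanishes by \<open>fst_D2_eq_0\<close>, the vertical Christoffel symbol has
  first component (i/2) b^2, and the vertical rest is killed by \<open>fst_D_eq_0\<close>.\<close>

lemma fst_D_square:
  assumes p: "p \<in> HC"
  shows "fst (D p (\<i> * b\<^sup>2, 0)) = \<i> * (snd (D p (0, b)))\<^sup>2"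
proof -
  have v0: "vert q (0, b) = b" for q b by (simp add: vert_def)
  have v1: "vert (\<psi> p) (D p (0, b)) = snd (D p (0, b))"
    by (simp add: vert_def fst_D_eq_0[OF p])
  have "0 = fst (D p (christoffel p (0, b) (0, b))) - christoffel_fst (\<psi> p) (D p (0, b)) (D p (0, b))"
    using arg_cong[OF second_derivative_eq[OF p, of "(0, b)" "(0, b)"], of fst] fst_D2_eq_0[OF p, of "(0, b)" "(0, b)"] by simp
  also have "christoffel p (0, b) (0, b) = (1 / 2) *\<^sub>R (\<i> * b\<^sup>2, 0) + (0, snd (christoffel p (0, b) (0, b)))"
    by (simp add: christoffel_def christoffel_fst_def v0 power2_eq_square scaleR_conv_of_real)
  also have "fst (D p \<dots>) = (1 / 2) *\<^sub>R fst (D p (\<i> * b\<^sup>2, 0))"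
    unfolding linear_add[OF linear_D[OF p]] linear_scale[OF linear_D[OF p]] by (simp add: fst_D_eq_0[OF p])
  finally show ?thesis
    by (simp add: christoffel_fst_def v1 fst_D_eq_0[OF p] scaleR_conv_of_real power2_eq_square field_simps)
qed

definition \<alpha> where "\<alpha> p = snd (D p (0, 1))"

lemma norm_\<alpha>: assumes p: "p \<in> HC" shows "(Re (\<alpha> p))\<^sup>2 + (Im (\<alpha> p))\<^sup>2 = Im (fst (\<psi> p)) / Im (fst p)"
  using vert_D_inner[OF p, of "(0,1)" "(0,1)"] Im_fst[OF p]
  by (simp add: vert_def fst_D_eq_0[OF p] \<alpha>_def inner_complex_def power2_eq_square field_simps)

lemma \<alpha>_nonzero: "p \<in> HC \<Longrightarrow> \<alpha> p \<noteq> 0"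
  using norm_\<alpha>[of p] Im_fst[of p] by auto

lemma has_derivative_\<alpha>: "p \<in> HC \<Longrightarrow> (\<alpha> has_derivative (\<lambda>w. snd (D2 p w (0, 1)))) (at p)"
  unfolding \<alpha>_def by (rule has_derivative_snd[OF D2])

text \<open>For b = 1 and b = i, \<open>fst_D_square\<close> has opposite arguments, so the images
  of (0, 1) and (0, i) have opposite squares. The resulting sign \<open>e p\<close> is continuous on
  the connected set \<open>HC\<close>, hence constant.\<close>

lemma linear_or_antilinear:
  "(\<forall>p\<in>HC. snd (D p (0, \<i>)) = \<i> * \<alpha> p) \<or> (\<forall>p\<in>HC. snd (D p (0, \<i>)) = - \<i> * \<alpha> p)"
proof -
  define e where "e p = snd (D p (0, \<i>)) / (\<i> * \<alpha> p)" for p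
  have e: "e p \<in> {1, -1}" if p: "p \<in> HC" for p
  proof -
    have "\<i> * (\<alpha> p)\<^sup>2 = fst (D p (\<i>, 0))" using fst_D_square[OF p, of 1] by (simp add: \<alpha>_def)
    also have "\<dots> = - fst (D p (- \<i>, 0))"
      using linear_neg[OF linear_D[OF p], of "(\<i>, 0)"] by simp
    also have "\<dots> = - \<i> * (snd (D p (0, \<i>)))\<^sup>2" using fst_D_square[OF p, of \<i>] by simp
    finally have "\<i> * (snd (D p (0, \<i>)))\<^sup>2 = \<i> * (\<i> * \<alpha> p)\<^sup>2" by (simp add: power_mult_distrib)
    then have "(snd (D p (0, \<i>)))\<^sup>2 = (\<i> * \<alpha> p)\<^sup>2" by simp
    then have "(e p)\<^sup>2 = 1" using \<alpha>_nonzero[OF p] by (simp add: e_def power_divide)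
    then show ?thesis by (simp add: power2_eq_1_iff)
  qed
  have "continuous_on HC e"
  proof -
    have "isCont (\<lambda>q. D q v) p" if "p \<in> HC" for p v using has_derivative_continuous[OF D2[OF that]] .
    then have "continuous_on HC (\<lambda>q. D q v)" for v by (simp add: continuous_at_imp_continuous_on)
    then show ?thesis unfolding e_def \<alpha>_def
      using \<alpha>_nonzero unfolding \<alpha>_def by (auto intro!: continuous_intros)
  qed
  then have "e constant_on HC"
    using e by (intro continuous_finite_range_constant convex_connected convex_HC finite_subset[of "e ` HC" "{1,-1}"]) auto
  then obtain c where c: "\<And>p. p \<in> HC \<Longrightarrow> e p = c" unfolding constant_on_def by blast
  have "(\<i>, 0) \<in> HC" by (simp add: HC_iff)
  then have "c = 1 \<or> c = -1" using e c by fastforce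
  moreover have "snd (D p (0, \<i>)) = c * (\<i> * \<alpha> p)" if "p \<in> HC" for p
    using c[OF that] \<alpha>_nonzero[OF that] by (auto simp: e_def field_simps)
  ultimately show ?thesis by auto
qed

text \<open>The complex linear case; the antilinear one is brought back to it in
  \<open>ex_act\<close> by composing with \<open>flip\<close>.\<close>

context
  assumes hol: "\<And>p. p \<in> HC \<Longrightarrow> snd (D p (0, \<i>)) = \<i> * \<alpha> p"
begin

lemma snd_D_vertical: assumes p: "p \<in> HC" shows "snd (D p (0, b)) = \<alpha> p * b"
proof -
  have "(0, b) = Re b *\<^sub>R (0, 1) + Im b *\<^sub>R (0 :: complex, \<i>)"
    by (simp add: complex_eq_iff)
  then have "snd (D p (0, b)) = snd (D p (Re b *\<^sub>R (0, 1) + Im b *\<^sub>R (0 :: complex, \<i>)))" by simp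
  also have "\<dots> = Re b *\<^sub>R \<alpha> p + Im b *\<^sub>R (\<i> * \<alpha> p)"
    unfolding linear_add[OF linear_D[OF p]] linear_scale[OF linear_D[OF p]] using hol[OF p] by (simp add: \<alpha>_def)
  also have "\<dots> = \<alpha> p * b" by (simp add: complex_eq_iff algebra_simps)
  finally show ?thesis .
qed

lemma fst_D: assumes p: "p \<in> HC" shows "fst (D p w) = (\<alpha> p)\<^sup>2 * fst w"
proof -
  have sq: "fst (D p (\<i> * b\<^sup>2, 0)) = \<i> * (\<alpha> p * b)\<^sup>2" for b
    using fst_D_square[OF p, of b] by (simp add: snd_D_vertical[OF p])
  have "w = (fst w, 0) + (0, snd w)" by (simp add: prod_eq_iff)
  then have "fst (D p w) = fst (D p (fst w, 0)) + fst (D p (0, snd w))"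
    by (metis linear_add[OF linear_D[OF p]] fst_add)
  also have "\<dots> = fst (D p (fst w, 0))" by (simp add: fst_D_eq_0[OF p])
  also have "\<dots> = (\<alpha> p)\<^sup>2 * fst w"
    \<comment> \<open>Every complex number has the form i b^2; this b produces
      \<open>fst w\<close>.\<close>
    using sq[of "csqrt (- \<i> * fst w)"] by (simp add: power_mult_distrib complex_eq_iff algebra_simps)
  finally show ?thesis .
qed

lemma snd_D: assumes p: "p \<in> HC"
  shows "snd (D p w) = \<alpha> p * vert p w + of_real (slope (\<psi> p)) * ((\<alpha> p)\<^sup>2 * fst w)"
proof -
  \<comment> \<open>\<open>?h\<close> is the horizontal lift of \<open>fst w\<close>, whose image is
    again horizontal by \<open>vert_D_eq_0\<close>.\<close>
  let ?h = "(fst w, of_real (slope p) * fst w)"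
  have "w = ?h + (0, vert p w)" by (simp add: prod_eq_iff vert_def)
  then have "snd (D p w) = snd (D p ?h) + snd (D p (0, vert p w))"
    by (metis linear_add[OF linear_D[OF p]] snd_add)
  moreover have "snd (D p ?h) = of_real (slope (\<psi> p)) * fst (D p ?h)"
    using vert_D_eq_0[OF p, of ?h] by (simp add: vert_def)
  ultimately show ?thesis by (simp add: snd_D_vertical[OF p] fst_D[OF p])
qed

lemma vert_D_vertical: "p \<in> HC \<Longrightarrow> vert (\<psi> p) (D p (0, b)) = \<alpha> p * b"
  by (simp add: vert_def fst_D_eq_0 snd_D_vertical)

text \<open>\<alpha>^2 is the first component of \<open>D q (1, 0)\<close>. Its derivative along (0,
  1) is, by symmetry of \<open>D2\<close>, a derivative of the vanishing function
  \<open>fst (D q (0, 1))\<close>; then divide by 2 \<alpha>.\<close>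

lemma \<alpha>_vertical_derivative: assumes p: "p \<in> HC" shows "snd (D2 p (0, 1) (0, 1)) = 0"
proof -
  have "((\<lambda>q. (\<alpha> q)\<^sup>2) has_derivative (\<lambda>w. fst (D2 p w (1, 0)))) (at p)"
    by (rule has_derivative_transform_within_open[OF has_derivative_fst[OF D2[OF p]] open_HC p])
      (simp add: fst_D)
  moreover have "((\<lambda>q. (\<alpha> q)\<^sup>2) has_derivative (\<lambda>w. 2 * \<alpha> p * snd (D2 p w (0, 1)))) (at p)"
    by (auto intro!: derivative_eq_intros has_derivative_\<alpha>[OF p])
  ultimately have "fst (D2 p (0, 1) (1, 0)) = 2 * \<alpha> p * snd (D2 p (0, 1) (0, 1))"
    using has_derivative_unique by metis
  moreover have "fst (D2 p (0, 1) (1, 0)) = 0"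
    unfolding D2_sym[OF p, of "(0,1)"] using fst_D2_eq_0[OF p] by simp
  ultimately show ?thesis using \<alpha>_nonzero[OF p] by simp
qed

text \<open>By symmetry of \<open>D2\<close>, the derivative of \<alpha> along w is that of
  \<open>snd (D q w)\<close> along (0, 1). In \<open>snd_D\<close> all derivatives of \<alpha> then
  drop out, and only the change of the slope at the image point contributes.\<close>

lemma \<alpha>_derivative: assumes p: "p \<in> HC"
  shows "(\<alpha> has_derivative (\<lambda>w. of_real (Im (\<alpha> p) / Im (fst (\<psi> p))) * (\<alpha> p)\<^sup>2 * fst w)) (at p)"
proof -
  have "snd (D2 p (0, 1) w) = of_real (Im (\<alpha> p) / Im (fst (\<psi> p))) * (\<alpha> p)\<^sup>2 * fst w" for w
  proof -
    let ?E = "\<lambda>h. snd (D2 p h (0, 1)) * vert p w + \<alpha> p * (- of_real (Im (vert p h) / Im (fst p)) * fst w)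
       + (of_real (Im (vert (\<psi> p) (D p h)) / Im (fst (\<psi> p))) * ((\<alpha> p)\<^sup>2 * fst w)
       + of_real (slope (\<psi> p)) * (2 * \<alpha> p * snd (D2 p h (0, 1)) * fst w))"
    have "((\<lambda>q. \<alpha> q * vert q w + of_real (slope (\<psi> q)) * ((\<alpha> q)\<^sup>2 * fst w)) has_derivative ?E) (at p)"
      by (auto intro!: derivative_eq_intros has_derivative_\<alpha>[OF p] has_derivative_vert[OF p]
        has_derivative_compose[OF D[OF p] has_derivative_slope[OF maps[OF p]]] simp: fun_eq_iff)
    then have "((\<lambda>q. snd (D q w)) has_derivative ?E) (at p)"
      by (rule has_derivative_transform_within_open[OF _ open_HC p]) (simp add: snd_D)
    from fun_cong[OF has_derivative_unique[OF has_derivative_snd[OF D2[OF p]] this], of "(0, 1)"]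
    have "snd (D2 p (0, 1) w) = ?E (0, 1)" .
    then show ?thesis
      by (simp add: \<alpha>_vertical_derivative[OF p] vert_D_vertical[OF p]) (simp add: vert_def)
  qed
  then show ?thesis using has_derivative_\<alpha>[OF p] by (simp add: D2_sym[OF p, of _ "(0, 1)"])
qed

text \<open>
  The constants \<open>c, d\<close> come from \<open>1/\<alpha>\<close>, \<open>a, b\<close> from \<open>f/\<alpha>\<close>, and \<open>l, m\<close> from \<open>S/\<alpha> - z\<close>.
\<close>

lemma moebius_form:
  "\<exists>a b c d l m. a * d - b * c = 1 \<and> (\<forall>p\<in>HC. \<psi> p =
     ((of_real a * fst p + of_real b) / (of_real c * fst p + of_real d),
      (snd p + of_real l * fst p + of_real m) / (of_real c * fst p + of_real d)))"
proof -
  \<comment> \<open>Division by \<alpha> is multiplication by its conjugate over |\<alpha>|^2, and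
    \<open>norm_\<alpha>\<close> gives |\<alpha>|^2.\<close>
  have inv: "Im (z / \<alpha> p) = (Im z * Re (\<alpha> p) - Re z * Im (\<alpha> p)) * Im (fst p) / Im (fst (\<psi> p))" if "p \<in> HC" for p z
    using norm_\<alpha>[OF that] Im_fst[OF that] by (simp add: Im_divide)
  have d1: "((\<lambda>p. 1 / \<alpha> p) has_derivative (\<lambda>w. of_real (Im (1 / \<alpha> p) / Im (fst p)) * fst w)) (at p)"
    if p: "p \<in> HC" for p
    using \<alpha>_nonzero[OF p] Im_fst[OF p] unfolding inv[OF p]
    by (auto intro!: derivative_eq_intros \<alpha>_derivative[OF p] simp: fun_eq_iff field_simps power2_eq_square)
  have d2: "((\<lambda>p. fst (\<psi> p) / \<alpha> p) has_derivative (\<lambda>w. of_real (Im (fst (\<psi> p) / \<alpha> p) / Im (fst p)) * fst w)) (at p)"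
    if p: "p \<in> HC" for p
  proof -
    let ?Y = "Im (fst (\<psi> p))"
    \<comment> \<open>The right side is the coefficient that the quotient rule yields; it is real
      because \<open>?Y\<close> is the imaginary part of \<open>fst (\<psi> p)\<close>.\<close>
    have "of_real (Im (fst (\<psi> p) / \<alpha> p) / Im (fst p)) = \<alpha> p - fst (\<psi> p) * of_real (Im (\<alpha> p) / ?Y)"
      using Im_fst[OF p] unfolding inv[OF p] by (simp add: complex_eq_iff field_simps)
    note eq = this
    show ?thesis unfolding eq using \<alpha>_nonzero[OF p]
      by (auto intro!: derivative_eq_intros \<alpha>_derivative[OF p] D[OF p] simp: fun_eq_iff fst_D[OF p] field_simps power2_eq_square)
  qed
  have d3: "((\<lambda>p. snd (\<psi> p) / \<alpha> p - snd p) has_derivative (\<lambda>w. of_real (Im (snd (\<psi> p) / \<alpha> p - snd p) / Im (fst p)) * fst w)) (at p)"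
    if p: "p \<in> HC" for p
  proof -
    let ?Y = "Im (fst (\<psi> p))"
    \<comment> \<open>Again the coefficient from the quotient rule; the imaginary parts cancel since
      the slope at \<open>\<psi> p\<close> is Im S / \<open>?Y\<close>.\<close>
    have "of_real (Im (snd (\<psi> p) / \<alpha> p - snd p) / Im (fst p))
        = of_real (slope (\<psi> p)) * \<alpha> p - snd (\<psi> p) * of_real (Im (\<alpha> p) / ?Y) - of_real (slope p)"
      using Im_fst[OF p] unfolding inv[OF p] minus_complex.sel by (simp add: complex_eq_iff slope_def field_simps)
    note eq = this
    show ?thesis unfolding eq using \<alpha>_nonzero[OF p]
      by (auto intro!: derivative_eq_intros \<alpha>_derivative[OF p] D[OF p] simp: fun_eq_iff snd_D[OF p] vert_def field_simps power2_eq_square)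
  qed
  obtain c d where cd: "\<And>p. p \<in> HC \<Longrightarrow> 1 / \<alpha> p = of_real c * fst p + of_real d"
    using affine_of_derivative[OF d1] by blast
  obtain a b where ab: "\<And>p. p \<in> HC \<Longrightarrow> fst (\<psi> p) / \<alpha> p = of_real a * fst p + of_real b"
    using affine_of_derivative[OF d2] by blast
  obtain l m where lm: "\<And>p. p \<in> HC \<Longrightarrow> snd (\<psi> p) / \<alpha> p - snd p = of_real l * fst p + of_real m"
    using affine_of_derivative[OF d3] by blast
  have form: "\<psi> p = ((of_real a * fst p + of_real b) / (of_real c * fst p + of_real d),
      (snd p + of_real l * fst p + of_real m) / (of_real c * fst p + of_real d))" if p: "p \<in> HC" for p
    using \<alpha>_nonzero[OF p] cd[OF p, symmetric] ab[OF p, symmetric] lm[OF p] by (simp add: prod_eq_iff add.assoc flip: lm[OF p])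
  \<comment> \<open>At (i, 0) the imaginary part of the first component is computed twice, from
    \<open>norm_\<alpha>\<close> and from the fractional form; comparison gives the
    determinant.\<close>
  have "a * d - b * c = 1"
  proof -
    let ?p = "(\<i>, 0) :: complex \<times> complex"
    have p: "?p \<in> HC" by (simp add: HC_iff)
    have "1 / \<alpha> ?p = of_real c * \<i> + of_real d" using cd[OF p] by simp
    then have "\<alpha> ?p = 1 / (of_real c * \<i> + of_real d)" by (metis divide_divide_eq_right div_by_1 mult_1)
    then have "cmod (\<alpha> ?p) ^ 2 = 1 / (c\<^sup>2 + d\<^sup>2)" by (simp add: norm_divide power_divide cmod_power2 add.commute)
    then have 1: "Im (fst (\<psi> ?p)) = 1 / (c\<^sup>2 + d\<^sup>2)" using norm_\<alpha>[OF p] by (simp add: cmod_power2)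
    have "Im (fst (\<psi> ?p)) = (a * d - b * c) / (c\<^sup>2 + d\<^sup>2)"
      unfolding form[OF p] by (simp add: Im_divide add.commute)
    moreover have "c\<^sup>2 + d\<^sup>2 \<noteq> 0" using 1 Im_fst[OF p] by auto
    ultimately show ?thesis using 1 by (metis divide_cancel_right)
  qed
  then show ?thesis using form by blast
qed

end

end

section \<open>Calculus of \<open>C\<^sup>k\<close> maps\<close>

lemma Ck_on_cong:
  assumes "open S" "\<And>x. x \<in> S \<Longrightarrow> f x = g x"
  shows "Ck_on k S f \<longleftrightarrow> Ck_on k S g"
  using assms(2)
proof (induction k arbitrary: f g)
  case 0
  then show ?case by (simp cong: continuous_on_cong)
next
  case (Suc k)
  have d: "(f has_derivative L) (at x) \<longleftrightarrow> (g has_derivative L) (at x)" if "x \<in> S" for x L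
    using has_derivative_transform_within_open[OF _ assms(1) that] Suc.prems by metis
  have "frechet_derivative f (at x) = frechet_derivative g (at x)" if "x \<in> S" for x
    unfolding frechet_derivative_def d[OF that] ..
  then have "Ck_on k S (\<lambda>x. frechet_derivative f (at x) v) \<longleftrightarrow> Ck_on k S (\<lambda>x. frechet_derivative g (at x) v)" for v
    by (intro Suc.IH) simp
  then show ?case using d by (simp add: differentiable_def)
qed

lemma Ck_on_SucI:
  assumes "open S" "\<And>x. x \<in> S \<Longrightarrow> (f has_derivative f' x) (at x)"
    and "\<And>v. Ck_on k S (\<lambda>x. f' x v)"
  shows "Ck_on (Suc k) S f"
proof -
  have "Ck_on k S (\<lambda>x. frechet_derivative f (at x) v) \<longleftrightarrow> Ck_on k S (\<lambda>x. f' x v)" for v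
    by (intro Ck_on_cong assms(1)) (simp add: frechet_derivative_at[OF assms(2), symmetric])
  then show ?thesis using assms(2,3) by (auto simp: differentiable_def)
qed

lemma Ck_on_SucE:
  assumes "Ck_on (Suc k) S f"
  obtains f' where "\<And>x. x \<in> S \<Longrightarrow> (f has_derivative f' x) (at x)" "\<And>v. Ck_on k S (\<lambda>x. f' x v)"
  using assms by (auto simp: frechet_derivative_works intro: that)

lemma Ck_on_Suc_imp: "Ck_on (Suc k) S f \<Longrightarrow> Ck_on k S f"
proof (induction k arbitrary: f)
  case 0
  then show ?case
    by (auto intro!: continuous_at_imp_continuous_on dest: differentiable_imp_continuous_within)
next
  case (Suc k)
  then show ?case by simp
qed

lemma Ck_on_const: "Ck_on k S (\<lambda>x. c)"
  by (induction k arbitrary: c) simp_all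

lemma Ck_on_linear_comp:
  fixes L :: "'b::euclidean_space \<Rightarrow> 'c::euclidean_space"
  assumes "open S" "linear L"
  shows "Ck_on k S f \<Longrightarrow> Ck_on k S (\<lambda>x. L (f x))"
proof (induction k arbitrary: f)
  case 0
  then show ?case using linear_continuous_on_compose[OF _ assms(2)] by simp
next
  case (Suc k)
  obtain f' where f': "\<And>x. x \<in> S \<Longrightarrow> (f has_derivative f' x) (at x)" "\<And>v. Ck_on k S (\<lambda>x. f' x v)"
    using Ck_on_SucE[OF Suc.prems] by blast
  show ?case
  proof (rule Ck_on_SucI[OF assms(1)])
    show "((\<lambda>x. L (f x)) has_derivative (\<lambda>v. L (f' x v))) (at x)" if "x \<in> S" for x
      by (rule has_derivative_compose[OF f'(1)[OF that] linear_imp_has_derivative[OF assms(2)]])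
  qed (intro Suc.IH f'(2))
qed

text \<open>The charts are linear, so this case of the chain rule suffices; the derivative is again
  a map composed with \<open>L\<close>, which keeps the induction going.\<close>

lemma Ck_on_comp_linear:
  fixes L :: "'a::euclidean_space \<Rightarrow> 'b::euclidean_space" and f :: "'b \<Rightarrow> 'c::euclidean_space"
  assumes "open S" "open T" "linear L" "L ` S \<subseteq> T"
  shows "Ck_on k T f \<Longrightarrow> Ck_on k S (\<lambda>x. f (L x))"
proof (induction k arbitrary: f)
  case 0
  have "continuous_on S L" by (simp add: assms(3) linear_continuous_on linear_linear)
  then show ?case using continuous_on_compose2[OF _ _ assms(4)] 0 by auto
next
  case (Suc k)
  obtain f' where f': "\<And>x. x \<in> T \<Longrightarrow> (f has_derivative f' x) (at x)" "\<And>v. Ck_on k T (\<lambda>x. f' x v)"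
    using Ck_on_SucE[OF Suc.prems] by blast
  show ?case
  proof (rule Ck_on_SucI[OF assms(1)])
    show "((\<lambda>x. f (L x)) has_derivative (\<lambda>v. f' (L x) (L v))) (at x)" if "x \<in> S" for x
      using that assms(4) by (intro has_derivative_compose[OF linear_imp_has_derivative[OF assms(3)] f'(1)]) auto
  qed (rule Suc.IH[OF f'(2)])
qed

lemma Ck_on_add:
  assumes "open S"
  shows "Ck_on k S f \<Longrightarrow> Ck_on k S g \<Longrightarrow> Ck_on k S (\<lambda>x. f x + g x)"
proof (induction k arbitrary: f g)
  case 0
  then show ?case by (simp add: continuous_on_add)
next
  case (Suc k)
  obtain f' where f': "\<And>x. x \<in> S \<Longrightarrow> (f has_derivative f' x) (at x)" "\<And>v. Ck_on k S (\<lambda>x. f' x v)"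
    using Ck_on_SucE[OF Suc.prems(1)] by blast
  obtain g' where g': "\<And>x. x \<in> S \<Longrightarrow> (g has_derivative g' x) (at x)" "\<And>v. Ck_on k S (\<lambda>x. g' x v)"
    using Ck_on_SucE[OF Suc.prems(2)] by blast
  show ?case
    by (rule Ck_on_SucI[OF assms has_derivative_add[OF f'(1) g'(1)] Suc.IH[OF f'(2) g'(2)]])
qed

lemma Ck_on_Pair:
  assumes "open S" "Ck_on k S f" "Ck_on k S g"
  shows "Ck_on k S (\<lambda>x. (f x, g x))"
proof -
  have "linear (\<lambda>u. (u, 0))" "linear (\<lambda>u. (0, u))" by (auto intro!: linearI)
  from Ck_on_add[OF assms(1) Ck_on_linear_comp[OF assms(1) this(1) assms(2)] Ck_on_linear_comp[OF assms(1) this(2) assms(3)]]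
  show ?thesis by simp
qed

lemma Ck_on_mult:
  fixes f g :: "'a::euclidean_space \<Rightarrow> complex"
  assumes "open S"
  shows "Ck_on k S f \<Longrightarrow> Ck_on k S g \<Longrightarrow> Ck_on k S (\<lambda>x. f x * g x)"
proof (induction k arbitrary: f g)
  case 0
  then show ?case by (simp add: continuous_on_mult)
next
  case (Suc k)
  obtain f' where f': "\<And>x. x \<in> S \<Longrightarrow> (f has_derivative f' x) (at x)" "\<And>v. Ck_on k S (\<lambda>x. f' x v)"
    using Ck_on_SucE[OF Suc.prems(1)] by blast
  obtain g' where g': "\<And>x. x \<in> S \<Longrightarrow> (g has_derivative g' x) (at x)" "\<And>v. Ck_on k S (\<lambda>x. g' x v)"
    using Ck_on_SucE[OF Suc.prems(2)] by blast
  show ?case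
    by (rule Ck_on_SucI[OF assms has_derivative_mult[OF f'(1) g'(1)]
       Ck_on_add[OF assms Suc.IH[OF Ck_on_Suc_imp[OF Suc.prems(1)] g'(2)] Suc.IH[OF f'(2) Ck_on_Suc_imp[OF Suc.prems(2)]]]])
qed

lemma Ck_on_inverse:
  fixes f :: "'a::euclidean_space \<Rightarrow> complex"
  assumes "open S" "\<And>x. x \<in> S \<Longrightarrow> f x \<noteq> 0"
  shows "Ck_on k S f \<Longrightarrow> Ck_on k S (\<lambda>x. inverse (f x))"
proof (induction k)
  case 0
  then show ?case using assms by (auto intro!: continuous_intros)
next
  case (Suc k)
  obtain f' where f': "\<And>x. x \<in> S \<Longrightarrow> (f has_derivative f' x) (at x)" "\<And>v. Ck_on k S (\<lambda>x. f' x v)"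
    using Ck_on_SucE[OF Suc.prems(1)] by blast
  note inv = Suc.IH[OF Ck_on_Suc_imp[OF Suc.prems]]
  show ?case
  proof (rule Ck_on_SucI[OF assms(1)])
    \<comment> \<open>The sign is written as a constant factor so that \<open>Ck_on_mult\<close>
      applies.\<close>
    show "((\<lambda>x. inverse (f x)) has_derivative (\<lambda>v. (- 1) * (inverse (f x) * f' x v * inverse (f x)))) (at x)" if "x \<in> S" for x
      using Deriv.has_derivative_inverse[OF assms(2)[OF that] f'(1)[OF that]] by simp
  qed (intro Ck_on_mult[OF assms(1)] Ck_on_const inv f'(2))
qed

lemma Ck_on_linear:
  fixes L :: "'b::euclidean_space \<Rightarrow> 'c::euclidean_space"
  assumes "open S" "linear L"
  shows "Ck_on k S L"
proof (cases k)
  case 0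
  then show ?thesis by (simp add: assms linear_continuous_on linear_linear)
next
  case (Suc n)
  show ?thesis unfolding Suc
    by (rule Ck_on_SucI[OF assms(1) linear_imp_has_derivative[OF assms(2)] Ck_on_const])
qed

section \<open>The action of \<open>SL\<^sup>\<plusminus>(2,\<real>) \<ltimes> \<real>\<^sup>2\<close>\<close>

lemma carrier_SLpm_R2: "A \<in> carrier SLpm_R2 \<longleftrightarrow> det (fst A) = 1 \<or> det (fst A) = -1"
  by (cases A) (simp add: SLpm_R2_def SLpm_def)

lemma SLpm_R2_simps [simp]:
  "(M, X) \<otimes>\<^bsub>SLpm_R2\<^esub> (N, Y) = (M ** N, X v* N + Y)"
  "\<one>\<^bsub>SLpm_R2\<^esub> = (mat 1, 0)"
  by (simp_all add: SLpm_R2_def)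

lemma group_SLpm_R2: "group SLpm_R2"
proof (rule groupI)
  fix A assume "A \<in> carrier SLpm_R2"
  then obtain M X where A: "A = (M, X)" and M: "det M = 1 \<or> det M = -1"
    by (cases A) (auto simp: carrier_SLpm_R2)
  then have "invertible M" by (auto simp: invertible_det_nz)
  then obtain N where N: "N ** M = mat 1" using invertible_def by blast
  then have "det N * det M = 1" by (metis det_mul det_I)
  then have "det N = 1 \<or> det N = -1" using M by auto
  moreover have "(N, - (X v* N)) \<otimes>\<^bsub>SLpm_R2\<^esub> A = \<one>\<^bsub>SLpm_R2\<^esub>"
    using vector_matrix_left_distrib[of "- (X v* N)" "X v* N" M]
    by (simp add: A N vector_matrix_mul_assoc)
  ultimately show "\<exists>B\<in>carrier SLpm_R2. B \<otimes>\<^bsub>SLpm_R2\<^esub> A = \<one>\<^bsub>SLpm_R2\<^esub>"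
    by (intro bexI[of _ "(N, - (X v* N))"]) (auto simp: carrier_SLpm_R2)
qed (auto simp: carrier_SLpm_R2 det_mul matrix_mul_assoc vector_matrix_mul_assoc algebra_simps)

section \<open>Explicit formulas for the action\<close>

text \<open>Common to both branches of \<open>act\<close>: for determinant -1 it is applied to
  \<open>conj2 p\<close>, which lies over the lower half-plane. Hence the lemmas below ask for a
  nonzero, not a positive, imaginary part.\<close>

definition jacobi :: "real \<Rightarrow> real \<Rightarrow> real \<Rightarrow> real \<Rightarrow> real \<Rightarrow> real \<Rightarrow> complex \<times> complex \<Rightarrow> complex \<times> complex" where
  "jacobi a b c d l m p =
     ((of_real a * fst p + of_real b) / (of_real c * fst p + of_real d),
      (snd p + of_real l * fst p + of_real m) / (of_real c * fst p + of_real d))"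

definition conj2 :: "complex \<times> complex \<Rightarrow> complex \<times> complex" where
  "conj2 p = (cnj (fst p), cnj (snd p))"

lemma act_eq_jacobi:
  "act (M, X) p = jacobi (M$1$1) (M$1$2) (M$2$1) (M$2$2) (X$1) (X$2) (if det M = 1 then p else conj2 p)"
  by (cases p) (simp add: act_def jacobi_def conj2_def Let_def)

lemma jacobi_denominator_nonzero:
  assumes "a * d - b * c \<noteq> 0" "Im t \<noteq> 0"
  shows "complex_of_real c * t + of_real d \<noteq> 0"
  using assms by (auto simp: complex_eq_iff)

lemma conj2_jacobi: "conj2 (jacobi a b c d l m p) = jacobi a b c d l m (conj2 p)"
  by (simp add: conj2_def jacobi_def)

lemma jacobi_comp:
  assumes "a' * d' - b' * c' \<noteq> 0" "Im (fst p) \<noteq> 0"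
  shows "jacobi a b c d l m (jacobi a' b' c' d' l' m' p) =
    jacobi (a * a' + b * c') (a * b' + b * d') (c * a' + d * c') (c * b' + d * d')
      (l * a' + m * c' + l') (l * b' + m * d' + m') p"
proof -
  let ?q = "of_real c' * fst p + of_real d'"
  have q: "?q \<noteq> 0" by (rule jacobi_denominator_nonzero[OF assms])
  \<comment> \<open>Everything is put over the inner denominator, which then cancels in the outer
    quotient.\<close>
  have comb: "of_real s * (x / ?q) + of_real t = (of_real s * x + of_real t * ?q) / ?q"
    "(y / ?q) + of_real s * (x / ?q) + of_real t = (y + of_real s * x + of_real t * ?q) / ?q"
    "(x / ?q) / (y / ?q) = x / y" for s t x y
    using q by (simp_all add: add_divide_distrib)
  show ?thesis using q unfolding jacobi_def fst_conv snd_conv comb by (simp add: algebra_simps)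
qed

lemma jacobi_Im:
  "Im (fst (jacobi a b c d l m p)) = (a * d - b * c) * Im (fst p) / (cmod (of_real c * fst p + of_real d))\<^sup>2"
  by (simp add: jacobi_def Im_divide cmod_power2 algebra_simps)

lemma act_in_HC:
  assumes "A \<in> carrier SLpm_R2" "p \<in> HC"
  shows "act A p \<in> HC"
proof (cases A)
  case (Pair M X)
  have "cmod (of_real (M$2$1) * t + of_real (M$2$2)) > 0" if "Im t \<noteq> 0" for t
    using jacobi_denominator_nonzero[of "M$1$1" "M$2$2" "M$1$2" "M$2$1" t] that assms(1) Pair by (auto simp: carrier_SLpm_R2 det_2)
  then show ?thesis using assms
    by (auto simp: HC_iff Pair act_eq_jacobi jacobi_Im carrier_SLpm_R2 det_2 conj2_def divide_neg_pos)
qed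

text \<open>The coefficients are real, so \<open>conj2\<close> commutes with \<open>jacobi\<close>;
  all four determinant cases reduce to \<open>jacobi_comp\<close>, and two conjugations
  cancel.\<close>

lemma act_mult:
  assumes A: "A \<in> carrier SLpm_R2" and B: "B \<in> carrier SLpm_R2" and p: "p \<in> HC"
  shows "act (A \<otimes>\<^bsub>SLpm_R2\<^esub> B) p = act A (act B p)"
proof -
  obtain M X N Y where AB: "A = (M, X)" "B = (N, Y)" by (cases A, cases B)
  have dets: "det M = 1 \<or> det M = -1" "det N = 1 \<or> det N = -1" using A B by (auto simp: AB carrier_SLpm_R2)
  have n: "N$1$1 * N$2$2 - N$1$2 * N$2$1 \<noteq> 0" using dets by (auto simp: det_2)
  have p': "Im (fst p) \<noteq> 0" "Im (fst (conj2 p)) \<noteq> 0" using p by (auto simp: HC_iff conj2_def)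
  have cc: "conj2 (conj2 p) = p" by (simp add: conj2_def)
  have entries: "(M ** N)$i$j = M$i$1 * N$1$j + M$i$2 * N$2$j" "(X v* N)$j = X$1 * N$1$j + X$2 * N$2$j" for i j
    by (simp_all add: matrix_matrix_mult_def vector_matrix_mult_def sum_2)
  show ?thesis using dets
    by (auto simp: AB act_eq_jacobi det_mul conj2_jacobi jacobi_comp[OF n p'(1)] jacobi_comp[OF n p'(2)] cc entries)
qed

lemma act_one: "act (mat 1, 0) p = p"
  by (simp add: act_eq_jacobi jacobi_def) (simp add: mat_def)

lemma act_trivial:
  assumes A: "A \<in> carrier SLpm_R2" and id: "\<And>p. p \<in> HC \<Longrightarrow> act A p = p"
  shows "A = \<one>\<^bsub>SLpm_R2\<^esub>"
proof -
  obtain M X where MX: "A = (M, X)" by (cases A)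
  let ?c = "M$2$1" and ?d = "M$2$2"
  have det: "det M = 1 \<or> det M = -1" using A by (auto simp: MX carrier_SLpm_R2)
  have q: "complex_of_real ?c * t + of_real ?d \<noteq> 0" if "Im t \<noteq> 0" for t
    using jacobi_denominator_nonzero[of "M$1$1" ?d "M$1$2" ?c t] that det by (auto simp: det_2)
  \<comment> \<open>On the imaginary axis the possible conjugation is multiplication by the sign
    \<open>e\<close>.\<close>
  define e where "e = (if det M = 1 then 1 else -1 :: real)"
  have *: "of_real (M$1$1) * Complex 0 (e * y) + of_real (M$1$2) = Complex 0 y * (of_real ?c * Complex 0 (e * y) + of_real ?d)"
    "Complex u (e * v) + of_real (X$1) * Complex 0 (e * y) + of_real (X$2) = Complex u v * (of_real ?c * Complex 0 (e * y) + of_real ?d)"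
    if "y > 0" for y u v
  proof -
    have nz: "Complex 0 y \<noteq> 0" "Complex 0 (- y) \<noteq> 0" using that by (simp_all add: complex_eq_iff)
    have "act A (Complex 0 y, Complex u v) = (Complex 0 y, Complex u v)" using id that by (simp add: HC_iff)
    then show "of_real (M$1$1) * Complex 0 (e * y) + of_real (M$1$2) = Complex 0 y * (of_real ?c * Complex 0 (e * y) + of_real ?d)"
    "Complex u (e * v) + of_real (X$1) * Complex 0 (e * y) + of_real (X$2) = Complex u v * (of_real ?c * Complex 0 (e * y) + of_real ?d)"
      using that q[of "Complex 0 (e * y)"] nz
      by (auto simp: MX act_eq_jacobi jacobi_def conj2_def e_def divide_eq_eq complex_cnj split: if_splits)
  qed
  \<comment> \<open>Comparing heights 1 and 2 gives c = 0; the fibre points 1 and i over \<tau> = i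
    then give d = 1 and e = d, which excludes determinant -1.\<close>
  have eqs: "M$1$2 = - ?c * e" "M$1$1 * e = ?d" "?c = 0" "?d = 1" "e = ?d" "X$1 = 0" "X$2 = 0"
    using *(1)[of 1] *(1)[of 2] *(2)[of 1 1 0] *(2)[of 1 0 1] *(2)[of 1 0 0]
    by (auto simp: complex_eq_iff e_def split: if_splits)
  then show ?thesis by (simp add: MX vec_eq_iff forall_2 mat_def)
qed

lemma Ck_on_act:
  assumes A: "A \<in> carrier SLpm_R2"
  shows "Ck_on k HC (act A)"
proof -
  obtain M X where MX: "A = (M, X)" by (cases A)
  let ?t = "\<lambda>p :: complex \<times> complex. if det M = 1 then p else conj2 p"
  let ?q = "\<lambda>p. of_real (M$2$1) * fst (?t p) + of_real (M$2$2)"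
  have lin: "linear (\<lambda>p. fst (?t p))" "linear (\<lambda>p. snd (?t p))"
    by (auto intro!: linearI simp: conj2_def)
  have q: "?q p \<noteq> 0" if "p \<in> HC" for p
    using jacobi_denominator_nonzero[of "M$1$1" "M$2$2" "M$1$2" "M$2$1"] that A
    by (auto simp: MX carrier_SLpm_R2 det_2 HC_iff conj2_def)
  note t = Ck_on_linear[OF open_HC lin(1), of k] and z = Ck_on_linear[OF open_HC lin(2), of k]
  note add = Ck_on_add[OF open_HC] and mult = Ck_on_mult[OF open_HC] and const = Ck_on_const
  note i = Ck_on_inverse[OF open_HC q add[OF mult[OF const t] const]]
  have "Ck_on k HC (\<lambda>p. ((of_real (M$1$1) * fst (?t p) + of_real (M$1$2)) * inverse (?q p),
     (snd (?t p) + of_real (X$1) * fst (?t p) + of_real (X$2)) * inverse (?q p)))"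
    by (rule Ck_on_Pair[OF open_HC mult[OF add[OF mult[OF const t] const] i]
        mult[OF add[OF add[OF z mult[OF const t]] const] i]])
  moreover have "act A = (\<lambda>p. ((of_real (M$1$1) * fst (?t p) + of_real (M$1$2)) * inverse (?q p),
     (snd (?t p) + of_real (X$1) * fst (?t p) + of_real (X$2)) * inverse (?q p)))"
    by (rule ext) (simp add: MX act_eq_jacobi jacobi_def divide_inverse)
  ultimately show ?thesis by simp
qed

section \<open>The reflection, and invariance of the metric under the group\<close>

definition flip :: "complex \<times> complex \<Rightarrow> complex \<times> complex" where
  "flip p = (- cnj (fst p), cnj (snd p))"

lemma flip_flip [simp]: "flip (flip p) = p"
  by (simp add: flip_def)

lemma linear_flip: "linear flip"
  by (auto intro!: linearI simp: flip_def)

lemma flip_in_HC: "p \<in> HC \<Longrightarrow> flip p \<in> HC"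
  by (simp add: HC_iff flip_def)

lemma gHC_flip: "gHC (flip p) (flip u) (flip v) = gHC p u v"
  by (simp add: gHC_def vert_def slope_def flip_def inner_complex_def algebra_simps)

definition flip_elem :: "(real^2^2) \<times> (real^2)" where
  "flip_elem = (vector [vector [-1, 0], vector [0, 1]], 0)"

lemma flip_elem_carrier: "flip_elem \<in> carrier SLpm_R2"
  and act_flip_elem: "act flip_elem p = flip p"
  by (simp_all add: flip_elem_def carrier_SLpm_R2 det_2 act_eq_jacobi jacobi_def conj2_def flip_def)

text \<open>Stated with some derivative \<open>L\<close>, so that explicit derivatives can be
  supplied and composed with \<open>flip\<close>.\<close>

definition isometric_at :: "(complex \<times> complex \<Rightarrow> complex \<times> complex) \<Rightarrow> complex \<times> complex \<Rightarrow> bool" where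
  "isometric_at f p \<longleftrightarrow>
     (\<exists>L. (f has_derivative L) (at p) \<and> (\<forall>u v. gHC (f p) (L u) (L v) = gHC p u v))"

text \<open>With q = c \<tau> + d, the coframe transforms by the factors 1/q^2 and 1/q, and y by
  1/|q|^2, so each summand of \<open>gHC\<close> is preserved.\<close>

lemma jacobi_isometric:
  assumes det: "a * d - b * c = 1" and p: "p \<in> HC"
  shows "isometric_at (jacobi a b c d l m) p"
proof -
  let ?q = "of_real c * fst p + of_real d"
  let ?N = "snd p + of_real l * fst p + of_real m"
  let ?f = "jacobi a b c d l m"
  let ?L = "\<lambda>w. (fst w / ?q\<^sup>2, (snd w + of_real l * fst w) / ?q - of_real c * fst w * ?N / ?q\<^sup>2)"
  have y: "Im (fst p) > 0" using p by (simp add: HC_iff)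
  have q: "?q \<noteq> 0" using det y by (intro jacobi_denominator_nonzero[of a d b]) auto
  have "complex_of_real a * of_real d - of_real b * of_real c = 1"
    by (metis det of_real_1 of_real_diff of_real_mult)
  then have det': "complex_of_real a * of_real d = 1 + of_real b * of_real c" by (simp add: algebra_simps)
  have 1: "(?f has_derivative ?L) (at p)"
    unfolding jacobi_def[abs_def]
    apply (rule has_derivative_Pair)
     apply (rule derivative_eq_intros refl q)+
     using q apply (simp add: fun_eq_iff divide_simps power2_eq_square)
     apply (simp add: algebra_simps det')
    apply (rule derivative_eq_intros refl q)+
    using q apply (simp add: fun_eq_iff divide_simps power2_eq_square)
    apply (simp add: algebra_simps)
    done
  have Y: "Im (fst (?f p)) = Im (fst p) / (cmod ?q)\<^sup>2" by (simp add: jacobi_Im det)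
  have "slope (?f p) = ((Im ?N) * Re ?q - Re ?N * Im ?q) / Im (fst p)"
    unfolding slope_def Y using q by (simp add: jacobi_def Im_divide cmod_power2)
  then have slope: "of_real (slope (?f p)) = (of_real l + of_real (slope p)) * ?q - of_real c * ?N"
    using y by (simp add: slope_def complex_eq_iff field_simps)
  then have vert: "vert (?f p) (?L w) = vert p w / ?q" for w
    unfolding vert_def fst_conv snd_conv slope using q
    by (simp add: divide_simps power2_eq_square) (simp add: algebra_simps)
  have inner_div: "(x / z) \<bullet> (x' / z) = (x \<bullet> x') / (cmod z)\<^sup>2" for x x' z :: complex
  proof -
    have "(x * k) \<bullet> (x' * k) = (x \<bullet> x') * (cmod k)\<^sup>2" for k
      by (simp add: inner_complex_def cmod_power2) (simp add: power2_eq_square algebra_simps)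
    from this[of "inverse z"] show ?thesis by (simp add: divide_inverse norm_inverse power_inverse)
  qed
  \<comment> \<open>Here r is |q|, while s and t are the inner products of the horizontal and
    vertical parts.\<close>
  have "s / (r\<^sup>2)\<^sup>2 / (2 * (Im (fst p) / r\<^sup>2)\<^sup>2) + t / r\<^sup>2 / (2 * (Im (fst p) / r\<^sup>2))
      = s / (2 * (Im (fst p))\<^sup>2) + t / (2 * Im (fst p))" if "r \<noteq> 0" for r s t :: real
    using that y by (simp add: field_simps)
  from this[of "cmod ?q"] have "gHC (?f p) (?L u) (?L v) = gHC p u v" for u v
    unfolding gHC_def vert Y fst_conv inner_div norm_power using q by simp
  then show ?thesis using 1 unfolding isometric_at_def by blast
qed

lemma act_isometric:
  assumes A: "A \<in> carrier SLpm_R2" and p: "p \<in> HC"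
  shows "isometric_at (act A) p"
proof -
  have det1: "isometric_at (act (M, X)) p" if "det M = 1" "p \<in> HC" for M X p
  proof -
    have "act (M, X) = jacobi (M$1$1) (M$1$2) (M$2$1) (M$2$2) (X$1) (X$2)"
      using that by (auto simp: act_eq_jacobi)
    then show ?thesis using that by (simp add: jacobi_isometric det_2)
  qed
  obtain M X where MX: "A = (M, X)" by (cases A)
  consider "det M = 1" | "det M = -1" using A by (auto simp: MX carrier_SLpm_R2)
  then show ?thesis
  proof cases
    case 1
    then show ?thesis using det1 p by (simp add: MX)
  next
    case 2
    \<comment> \<open>\<open>?B\<close> has determinant 1, and A is \<open>?B\<close> after the
      reflection.\<close>
    let ?B = "A \<otimes>\<^bsub>SLpm_R2\<^esub> flip_elem"
    have "det (M ** fst flip_elem) = 1" using 2 by (simp add: det_mul) (simp add: flip_elem_def det_2)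
    then have "isometric_at (act ?B) (flip p)"
      using det1 flip_in_HC[OF p] by (simp add: MX flip_elem_def)
    then obtain L where L: "(act ?B has_derivative L) (at (flip p))"
      "\<And>u v. gHC (act ?B (flip p)) (L u) (L v) = gHC (flip p) u v"
      unfolding isometric_at_def by blast
    have eq: "act ?B (flip q) = act A q" if "q \<in> HC" for q
      using act_mult[OF A flip_elem_carrier flip_in_HC[OF that]] by (simp add: act_flip_elem)
    have "((\<lambda>q. act ?B (flip q)) has_derivative (\<lambda>w. L (flip w))) (at p)"
      by (rule has_derivative_compose[OF linear_imp_has_derivative[OF linear_flip] L(1)])
    then have "(act A has_derivative (\<lambda>w. L (flip w))) (at p)"
      by (rule has_derivative_transform_within_open[OF _ open_HC p eq])
    moreover have "gHC (act A p) (L (flip u)) (L (flip v)) = gHC p u v" for u v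
      using L(2)[of "flip u" "flip v"] by (simp add: eq[OF p] gHC_flip)
    ultimately show ?thesis unfolding isometric_at_def by blast
  qed
qed

lemma (in HC_isometry) ex_act:
  "\<exists>A\<in>carrier SLpm_R2. \<forall>p\<in>HC. \<psi> p = act A p"
  using linear_or_antilinear
proof
  have rep: "\<exists>A\<in>carrier SLpm_R2. \<forall>p\<in>HC. f p = act A p"
    if "\<exists>a b c d l m. a * d - b * c = 1 \<and> (\<forall>p\<in>HC. f p =
     ((of_real a * fst p + of_real b) / (of_real c * fst p + of_real d),
      (snd p + of_real l * fst p + of_real m) / (of_real c * fst p + of_real d)))" for f
  proof -
    from that obtain a b c d l m where *: "a * d - b * c = 1" "\<And>p. p \<in> HC \<Longrightarrow> f p = jacobi a b c d l m p"
      unfolding jacobi_def by blast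
    then show ?thesis
      by (intro bexI[of _ "(vector [vector [a, b], vector [c, d]], vector [l, m])"])
        (simp_all add: act_eq_jacobi det_2 carrier_SLpm_R2)
  qed
  {
    assume "\<forall>p\<in>HC. snd (D p (0, \<i>)) = \<i> * \<alpha> p"
    then show ?thesis by (intro rep moebius_form) blast
  next
    assume anti: "\<forall>p\<in>HC. snd (D p (0, \<i>)) = - \<i> * \<alpha> p"
    note fl = has_derivative_compose[OF _ linear_imp_has_derivative[OF linear_flip]]
    \<comment> \<open>\<open>flip\<close> is linear, so it acts on every derivative directly; it
      turns the antilinear map into a linear one.\<close>
    interpret flipped: HC_isometry "\<lambda>p. flip (\<psi> p)" "\<lambda>p v. flip (D p v)" "\<lambda>p w v. flip (D2 p w v)"
      "\<lambda>p x w v. flip (D3 p x w v)"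
      by unfold_locales (simp_all add: flip_in_HC maps fl[OF D] fl[OF D2] fl[OF D3] gHC_flip isometric)
    have "snd (flip (D p (0, \<i>))) = \<i> * flipped.\<alpha> p" if "p \<in> HC" for p
      using anti that unfolding flipped.\<alpha>_def \<alpha>_def by (simp add: flip_def)
    from rep[OF flipped.moebius_form[OF this]]
    obtain A where A: "A \<in> carrier SLpm_R2" "\<And>p. p \<in> HC \<Longrightarrow> flip (\<psi> p) = act A p" by blast
    \<comment> \<open>\<open>flip\<close> is an involution, so it is undone by multiplying with
      \<open>flip_elem\<close> on the left.\<close>
    have "\<psi> p = act (flip_elem \<otimes>\<^bsub>SLpm_R2\<^esub> A) p" if "p \<in> HC" for p
      using act_mult[OF flip_elem_carrier A(1) that] A(2)[OF that, symmetric]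
      by (simp add: act_flip_elem)
    moreover have "flip_elem \<otimes>\<^bsub>SLpm_R2\<^esub> A \<in> carrier SLpm_R2"
      using group.is_monoid[OF group_SLpm_R2] flip_elem_carrier A(1) by (rule monoid.m_closed)
    ultimately show ?thesis by blast
  }
qed

section \<open>Transport to the tangent bundle \<open>TN\<close>\<close>

text \<open>A linear inverse on the whole space, so it is its own derivative; it agrees with
  \<open>inv_into TN ident\<close> on \<open>HC\<close>.\<close>

definition ident_inv :: "complex \<times> complex \<Rightarrow> point" where
  "ident_inv p = (vector [Im (snd p), - Im (fst p)], vector [- Re (snd p), Re (fst p)])"

lemma ident_simps: "fst (ident p) = Complex (snd p $ 2) (- fst p $ 2)"
  "snd (ident p) = Complex (- snd p $ 1) (fst p $ 1)"
  by (cases p; simp add: ident_def Let_def complex_eq_iff)+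

lemma ident_ident_inv [simp]: "ident (ident_inv p) = p"
  by (simp add: prod_eq_iff ident_simps ident_inv_def complex_eq_iff)

lemma ident_inv_ident [simp]: "ident_inv (ident p) = p"
  by (simp add: prod_eq_iff ident_simps ident_inv_def vec_eq_iff forall_2)

lemma linear_ident: "linear ident"
  by (auto intro!: linearI simp: prod_eq_iff ident_simps complex_eq_iff)

lemma linear_ident_inv: "linear ident_inv"
  by (auto intro!: linearI simp: ident_inv_def vec_eq_iff forall_2)

lemma ident_in_HC: "ident p \<in> HC \<longleftrightarrow> p \<in> TN"
  by (cases p) (simp add: HC_iff ident_simps TN_def)

lemma ident_inv_in_TN: "ident_inv p \<in> TN \<longleftrightarrow> p \<in> HC"
  by (metis ident_ident_inv ident_in_HC)

lemma open_TN: "open TN"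
proof -
  have "TN = ident -` HC" by (intro equalityI subsetI) (simp_all add: ident_in_HC)
  then show ?thesis
    using open_HC continuous_open_vimage linear_ident linear_continuous_at linear_linear by metis
qed

lemma inv_into_ident: "p \<in> HC \<Longrightarrow> inv_into TN ident p = ident_inv p"
  using inv_into_f_eq[OF bij_betw_imp_inj_on[OF bij_betw_ident]] by (simp add: ident_inv_in_TN)

text \<open>Here y = -\<theta>_2 and v = \<theta>_1, and completing the square in the Fisher form
  gives h(w, w) = w_2^2 / (2 y^2) + (w_1 + (v/y) w_2)^2 / (2 y). Tangent vectors are carried by the
  linear map \<open>ident\<close> itself.\<close>

lemma gTN_eq_gHC: "p \<in> TN \<Longrightarrow> gTN p u v = gHC (ident p) (ident u) (ident v)"
proof -
  assume "p \<in> TN"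
  then have y: "fst p $ 2 \<noteq> 0" by (auto simp: TN_def)
  show ?thesis using y
    apply (simp add: gTN_def fisher_def gHC_def vert_def slope_def ident_simps inner_complex_def
       case_prod_beta inner_vec_def matrix_vector_mult_def sum_2)
    apply (simp add: field_simps power2_eq_square)
    done
qed

lemma act_TN_eq: "A \<in> carrier SLpm_R2 \<Longrightarrow> p \<in> TN \<Longrightarrow> act_TN A p = ident_inv (act A (ident p))"
  by (simp add: act_TN_def inv_into_ident act_in_HC ident_in_HC)

lemma act_TN_in_TN: "A \<in> carrier SLpm_R2 \<Longrightarrow> p \<in> TN \<Longrightarrow> act_TN A p \<in> TN"
  by (simp add: act_TN_eq ident_inv_in_TN act_in_HC ident_in_HC)

lemma act_TN_mult:
  assumes "A \<in> carrier SLpm_R2" "B \<in> carrier SLpm_R2" "p \<in> TN"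
  shows "act_TN (A \<otimes>\<^bsub>SLpm_R2\<^esub> B) p = act_TN A (act_TN B p)"
proof -
  have "A \<otimes>\<^bsub>SLpm_R2\<^esub> B \<in> carrier SLpm_R2"
    using group.is_monoid[OF group_SLpm_R2] assms(1,2) by (rule monoid.m_closed)
  then show ?thesis using assms
    by (simp add: act_TN_eq[OF assms(1) act_TN_in_TN[OF assms(2,3)]])
      (simp add: act_TN_eq act_mult ident_in_HC)
qed

lemma act_TN_one: "p \<in> TN \<Longrightarrow> act_TN \<one>\<^bsub>SLpm_R2\<^esub> p = p"
  using act_TN_eq[OF monoid.one_closed[OF group.is_monoid[OF group_SLpm_R2]]] by (simp add: act_one)

lemma act_TN_Bij:
  assumes A: "A \<in> carrier SLpm_R2"
  shows "act_TN A \<in> Bij TN"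
proof -
  let ?B = "inv\<^bsub>SLpm_R2\<^esub> A"
  have B: "?B \<in> carrier SLpm_R2" using group.inv_closed[OF group_SLpm_R2 A] .
  have "act_TN ?B (act_TN A p) = p" "act_TN A (act_TN ?B p) = p" if "p \<in> TN" for p
    using act_TN_mult[OF A B that] act_TN_mult[OF B A that] act_TN_one[OF that]
      group.l_inv[OF group_SLpm_R2 A] group.r_inv[OF group_SLpm_R2 A] by simp_all
  then have "bij_betw (act_TN A) TN TN"
    using act_TN_in_TN[OF A] act_TN_in_TN[OF B] by (intro bij_betw_byWitness[of _ "act_TN ?B"]) blast+
  then show ?thesis by (simp add: Bij_def act_TN_def)
qed

lemma inv_into_act_TN:
  assumes A: "A \<in> carrier SLpm_R2" and p: "p \<in> TN"
  shows "inv_into TN (act_TN A) p = act_TN (inv\<^bsub>SLpm_R2\<^esub> A) p"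
proof -
  let ?B = "inv\<^bsub>SLpm_R2\<^esub> A"
  have B: "?B \<in> carrier SLpm_R2" using group.inv_closed[OF group_SLpm_R2 A] .
  have "act_TN A (act_TN ?B p) = p"
    using act_TN_mult[OF A B p] act_TN_one[OF p] group.r_inv[OF group_SLpm_R2 A] by simp
  then show ?thesis using act_TN_Bij[OF A] act_TN_in_TN[OF B p]
    by (intro inv_into_f_eq) (auto simp: Bij_def bij_betw_def)
qed

lemma Ck_on_act_TN:
  assumes A: "A \<in> carrier SLpm_R2"
  shows "Ck_on k TN (act_TN A)"
proof -
  have "Ck_on k TN (\<lambda>p. ident_inv (act A (ident p)))"
    by (intro Ck_on_linear_comp[OF open_TN linear_ident_inv]
        Ck_on_comp_linear[OF open_TN open_HC linear_ident _ Ck_on_act[OF A]]) (auto simp: ident_in_HC)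
  then show ?thesis using Ck_on_cong[OF open_TN, of "act_TN A"] by (simp add: act_TN_eq[OF A])
qed

lemma act_TN_Isom:
  assumes A: "A \<in> carrier SLpm_R2"
  shows "act_TN A \<in> Isom_TN"
proof -
  have "Ck_on k TN (inv_into TN (act_TN A))" for k
    using Ck_on_cong[OF open_TN, of "inv_into TN (act_TN A)"] inv_into_act_TN[OF A]
      Ck_on_act_TN[OF group.inv_closed[OF group_SLpm_R2 A]] by simp
  then have "act_TN A \<in> Diff TN"
    by (simp add: Diff_def smooth_on_def act_TN_Bij Ck_on_act_TN A)
  moreover have "pullback (act_TN A) gTN p = gTN p" if p: "p \<in> TN" for p
  proof -
    obtain L where L: "(act A has_derivative L) (at (ident p))"
      "\<And>u v. gHC (act A (ident p)) (L u) (L v) = gHC (ident p) u v"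
      using act_isometric[OF A, of "ident p"] p unfolding isometric_at_def ident_in_HC by blast
    have "((\<lambda>q. ident_inv (act A (ident q))) has_derivative (\<lambda>w. ident_inv (L (ident w)))) (at p)"
      by (rule has_derivative_compose[OF has_derivative_compose[OF linear_imp_has_derivative[OF linear_ident] L(1)]
         linear_imp_has_derivative[OF linear_ident_inv]])
    then have "(act_TN A has_derivative (\<lambda>w. ident_inv (L (ident w)))) (at p)"
      by (rule has_derivative_transform_within_open[OF _ open_TN p]) (simp add: act_TN_eq[OF A])
    from frechet_derivative_at[OF this, symmetric]
    have "pullback (act_TN A) gTN p u v = gTN p u v" for u v
      using act_TN_in_TN[OF A p] p unfolding pullback_def
      by (simp add: gTN_eq_gHC L(2)) (simp add: act_TN_eq[OF A p] L(2))
    then show ?thesis by (intro ext)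
  qed
  ultimately show ?thesis by (simp add: Isom_TN_def)
qed

lemma Isom_TN_imp_act:
  assumes "\<phi> \<in> Isom_TN"
  shows "\<exists>A\<in>carrier SLpm_R2. \<phi> = act_TN A"
proof -
  have \<phi>: "\<phi> \<in> Bij TN" "\<And>k. Ck_on k TN \<phi>" "\<And>p. p \<in> TN \<Longrightarrow> pullback \<phi> gTN p = gTN p"
    using assms by (auto simp: Isom_TN_def Diff_def smooth_on_def)
  define E where "E p v = frechet_derivative \<phi> (at p) v" for p v
  define E2 where "E2 p w v = frechet_derivative (\<lambda>q. E q v) (at p) w" for p w v
  define E3 where "E3 p x w v = frechet_derivative (\<lambda>q. E2 q w v) (at p) x" for p x w v
  \<comment> \<open>Three derivatives are what the curvature argument consumes.\<close>
  have "Ck_on (Suc (Suc (Suc 0))) TN \<phi>" by (rule \<phi>)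
  then have "\<phi> differentiable at p" "(\<lambda>q. E q v) differentiable at p" "(\<lambda>q. E2 q w v) differentiable at p"
    if "p \<in> TN" for p v w
    using that unfolding Ck_on.simps E_def E2_def by blast+
  then have E: "(\<phi> has_derivative E p) (at p)" "((\<lambda>q. E q v) has_derivative (\<lambda>w. E2 p w v)) (at p)"
    "((\<lambda>q. E2 q w v) has_derivative (\<lambda>x. E3 p x w v)) (at p)" if "p \<in> TN" for p v w
    using that unfolding frechet_derivative_works E_def[abs_def] E2_def[abs_def] E3_def[abs_def] by simp_all
  have maps: "\<phi> p \<in> TN" if "p \<in> TN" for p using Bij_imp_funcset[OF \<phi>(1)] that by blast
  have lift: "((\<lambda>p. ident (f (ident_inv p))) has_derivative (\<lambda>w. ident (f' (ident_inv w)))) (at p)"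
    if "(f has_derivative f') (at (ident_inv p))" for f f' p
    by (rule has_derivative_compose[OF has_derivative_compose[OF linear_imp_has_derivative[OF linear_ident_inv] that]
         linear_imp_has_derivative[OF linear_ident]])
  interpret HC_isometry "\<lambda>p. ident (\<phi> (ident_inv p))" "\<lambda>p v. ident (E (ident_inv p) (ident_inv v))"
    "\<lambda>p w v. ident (E2 (ident_inv p) (ident_inv w) (ident_inv v))"
    "\<lambda>p x w v. ident (E3 (ident_inv p) (ident_inv x) (ident_inv w) (ident_inv v))"
  proof
    fix p u v assume "p \<in> HC"
    then have p: "ident_inv p \<in> TN" by (simp add: ident_inv_in_TN)
    show "ident (\<phi> (ident_inv p)) \<in> HC" by (simp add: ident_in_HC maps[OF p])
    show "gHC (ident (\<phi> (ident_inv p))) (ident (E (ident_inv p) (ident_inv u))) (ident (E (ident_inv p) (ident_inv v))) = gHC p u v"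
      using fun_cong[OF fun_cong[OF \<phi>(3)[OF p], of "ident_inv u"], of "ident_inv v"]
      by (simp add: pullback_def gTN_eq_gHC[OF p] gTN_eq_gHC[OF maps[OF p]] E_def)
  qed (simp_all add: lift[OF E(1)] lift[OF E(2)] lift[OF E(3)] ident_inv_in_TN)
  obtain A where A: "A \<in> carrier SLpm_R2" "\<And>p. p \<in> HC \<Longrightarrow> ident (\<phi> (ident_inv p)) = act A p"
    using ex_act by blast
  have "\<phi> p = act_TN A p" if "p \<in> TN" for p
    using A(2)[of "ident p"] that by (simp add: ident_in_HC act_TN_eq[OF A(1)] flip: A(2))
  then have "\<phi> = act_TN A"
    using Bij_imp_extensional[OF \<phi>(1)] Bij_imp_extensional[OF act_TN_Bij[OF A(1)]] by (rule extensionalityI[rotated 2])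
  then show ?thesis using A(1) by blast
qed

section \<open>The isomorphism onto the isometry group\<close>

theorem theorem3p33:
  shows "subgroup Isom_TN (BijGroup TN)
    \<and> group SLpm_R2
    \<and> act_TN \<in> iso SLpm_R2 Isom_group
    \<and> Isom_TN = act_TN ` carrier SLpm_R2"
proof -
  have image: "Isom_TN = act_TN ` carrier SLpm_R2"
    using act_TN_Isom Isom_TN_imp_act by blast
  have mult: "act_TN (A \<otimes>\<^bsub>SLpm_R2\<^esub> B) = act_TN A \<otimes>\<^bsub>BijGroup TN\<^esub> act_TN B"
    if "A \<in> carrier SLpm_R2" "B \<in> carrier SLpm_R2" for A B
  proof -
    have "act_TN (A \<otimes>\<^bsub>SLpm_R2\<^esub> B) = compose TN (act_TN A) (act_TN B)"
    proof (rule extensionalityI[where A = TN])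
      show "act_TN (A \<otimes>\<^bsub>SLpm_R2\<^esub> B) \<in> extensional TN" by (simp add: act_TN_def)
    qed (simp_all add: act_TN_mult[OF that] compose_eq)
    then show ?thesis by (simp add: BijGroup_def act_TN_Bij[OF that(1)] act_TN_Bij[OF that(2)])
  qed
  \<comment> \<open>The target is first the full group \<open>BijGroup TN\<close>, so that the image
    of the homomorphism is a subgroup and the kernel criterion applies.\<close>
  have "act_TN \<in> hom SLpm_R2 (BijGroup TN)"
    using act_TN_Bij mult by (intro homI) (simp_all add: BijGroup_def)
  then interpret h: group_hom SLpm_R2 "BijGroup TN" act_TN
    using group_SLpm_R2 group_BijGroup by (simp add: group_hom_def group_hom_axioms_def)
  \<comment> \<open>Injectivity is effectiveness of the action, carried back to
    \<open>HC\<close>.\<close>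
  have "A = \<one>\<^bsub>SLpm_R2\<^esub>" if A: "A \<in> carrier SLpm_R2" and id: "act_TN A = \<one>\<^bsub>BijGroup TN\<^esub>" for A
  proof (rule act_trivial[OF A])
    fix p assume p: "p \<in> HC"
    then have "act_TN A (ident_inv p) = ident_inv p" by (simp add: id BijGroup_def ident_inv_in_TN)
    then have "ident_inv (act A p) = ident_inv p" using p by (simp add: act_TN_eq[OF A] ident_inv_in_TN)
    then show "act A p = p" by (metis ident_ident_inv)
  qed
  then have "kernel SLpm_R2 (BijGroup TN) act_TN = {\<one>\<^bsub>SLpm_R2\<^esub>}"
    using h.hom_one monoid.one_closed[OF group.is_monoid[OF group_SLpm_R2]] unfolding kernel_def by blast
  then have "inj_on act_TN (carrier SLpm_R2)" by (rule h.trivial_ker_imp_inj)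
  moreover have "act_TN \<in> hom SLpm_R2 Isom_group"
    using mult act_TN_Isom by (intro homI) simp_all
  ultimately have "act_TN \<in> iso SLpm_R2 Isom_group"
    by (simp add: iso_def bij_betw_def image)
  then show ?thesis
    using h.img_is_subgroup group_SLpm_R2 image by simp
qed

end
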